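(* If the capacity ratio $B\ge2$ and the column sparsity $d$ are known in advance, there is an online algorithm for submodular maximization subject to linear packing constraints that is $\Omega\!\left(\alpha d^{-\frac{1}{B-1}}\right)$-competitive: namely, Algorithm 3 modified to reject the first $pn$ items (sampling phase), with $p=1-\frac{1}{2e}\left(\frac{1}{2d}\right)^{\frac{1}{B-1}}$, and to behave like Algorithm 3 in rounds $\ell>pn$; there is an absolute constant $c_0>0$ such that its integral output $y$ satisfies $Ay\le b$ and $\mathbb{E}[F(y)]\ge(c_0\alpha d^{-\frac{1}{B-1}}-o(1))F^*$.
   Context: Linear packing setting. $U$ is a set of $n$ items; $A=(a_{i,j})\in\mathbb{R}_{\ge0}^{m\times U}$ and $b\in\mathbb{R}_{>0}^m$; w.l.o.g. $\max_j a_{i,j}\le1$ for each $i$. The capacity ratio is $B=\min_{i\in[m]} b_i/\max_{j} a_{i,j}$, and the column sparsity $d$ is the maximum number of nonzero entries in a column of $A$. $f\colon 2^U\to\mathbb{R}_{\ge0}$ is monotone submodular with multilinear extension $F(x)=\sum_{R\subseteq U}f(R)\prod_{i\in R}x_i\prod_{i\in U\setminus R}(1-x_i)$, $x\in[0,1]^U$, and $F^*=\sup\{F(x):x\in[0,1]^U,Ax\le b\}$. Items arrive one per round in uniformly random order; the column of item $j$ is revealed on arrival and the algorithm must immediately and irrevocably set $y_j\in\{0,1\}$, keeping $Ay\le b$. For $S\subseteq U$, $\mathcal{P}(\frac{\ell}{n},S)=\{x\in[0,1]^U: Ax\le\frac{\ell}{n}b,\ x_i=0\ \forall i\notin S\}$;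 the algorithm has access to an oracle $\mathcal{A}_F$ returning, for each such polytope $P$, a point $\mathcal{A}_F(P)\in P$ with $F(\mathcal{A}_F(P))\ge\alpha\sup_{x\in P}F(x)$, $\alpha\in(0,1]$. Algorithm 3: start with $x=0$, $S=\emptyset$; in round $\ell$, when item $j$ arrives, set $S:=S\cup\{j\}$, compute $\tilde x^{(\ell)}=\mathcal{A}_F(\mathcal{P}(\frac{\ell}{n},S))$, let $\hat x^{(\ell)}$ be $e_j$ with probability $\tilde x^{(\ell)}_j$ and $0$ otherwise; if $A(x+\hat x^{(\ell)})\le b$ set $x:=x+\hat x^{(\ell)}$; output $y=x$. *)

theory Defs
  imports "HOL-Probability.Probability" "HOL-Combinatorics.Permutations"
begin

text \<open>Items are U = {..<n}; constraint rows are {..<m}; the matrix A is a :: nat => nat => real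
  (a i j = entry in row i, column/item j); capacities b :: nat => real.\<close>

definition ind_vec :: "nat set \<Rightarrow> nat \<Rightarrow> real" where
  "ind_vec Y = (\<lambda>j. if j \<in> Y then 1 else 0)"

definition packing_ok :: "nat \<Rightarrow> nat \<Rightarrow> (nat \<Rightarrow> nat \<Rightarrow> real) \<Rightarrow> (nat \<Rightarrow> real) \<Rightarrow> (nat \<Rightarrow> real) \<Rightarrow> bool" where
  "packing_ok m n a b y \<longleftrightarrow> (\<forall>i<m. (\<Sum>j<n. a i j * y j) \<le> b i)"

text \<open>Capacity ratio B = min_i b_i / max_j a_ij (rows that are identically zero impose no
  constraint, i.e. have ratio +infinity, and are therefore skipped).\<close>
definition cap_ratio :: "nat \<Rightarrow> nat \<Rightarrow> (nat \<Rightarrow> nat \<Rightarrow> real) \<Rightarrow> (nat \<Rightarrow> real) \<Rightarrow> real" where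
  "cap_ratio m n a b =
     Min ((\<lambda>i. b i / Max ((\<lambda>j. a i j) ` {..<n})) ` {i. i < m \<and> (\<exists>j<n. a i j \<noteq> 0)})"

definition col_sparsity :: "nat \<Rightarrow> nat \<Rightarrow> (nat \<Rightarrow> nat \<Rightarrow> real) \<Rightarrow> nat" where
  "col_sparsity m n a = Max ((\<lambda>j. card {i. i < m \<and> a i j \<noteq> 0}) ` {..<n})"

definition monotone_set_fun :: "nat set \<Rightarrow> (nat set \<Rightarrow> real) \<Rightarrow> bool" where
  "monotone_set_fun U f \<longleftrightarrow> (\<forall>S T. S \<subseteq> T \<longrightarrow> T \<subseteq> U \<longrightarrow> f S \<le> f T)"

definition submodular_set_fun :: "nat set \<Rightarrow> (nat set \<Rightarrow> real) \<Rightarrow> bool" where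
  "submodular_set_fun U f \<longleftrightarrow>
     (\<forall>S T. S \<subseteq> U \<longrightarrow> T \<subseteq> U \<longrightarrow> f (S \<union> T) + f (S \<inter> T) \<le> f S + f T)"

definition multilinear_ext :: "nat \<Rightarrow> (nat set \<Rightarrow> real) \<Rightarrow> (nat \<Rightarrow> real) \<Rightarrow> real" where
  "multilinear_ext n f x =
     (\<Sum>R\<in>Pow {..<n}. f R * (\<Prod>i\<in>R. x i) * (\<Prod>i\<in>{..<n} - R. 1 - x i))"

text \<open>The polytope P(t, S) = {x in [0,1]^U : A x <= t b, x_i = 0 for i not in S}.
  (Coordinates outside U are also fixed to 0; F does not depend on them.)\<close>
definition polytope :: "nat \<Rightarrow> nat \<Rightarrow> (nat \<Rightarrow> nat \<Rightarrow> real) \<Rightarrow> (nat \<Rightarrow> real) \<Rightarrow> real \<Rightarrow> nat set \<Rightarrow> (nat \<Rightarrow> real) set" where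
  "polytope m n a b t S =
     {x. (\<forall>j<n. 0 \<le> x j \<and> x j \<le> 1) \<and> (\<forall>j. j \<notin> S \<longrightarrow> x j = 0) \<and>
         (\<forall>i<m. (\<Sum>j<n. a i j * x j) \<le> t * b i)}"

definition F_star :: "nat \<Rightarrow> nat \<Rightarrow> (nat \<Rightarrow> nat \<Rightarrow> real) \<Rightarrow> (nat \<Rightarrow> real) \<Rightarrow> (nat set \<Rightarrow> real) \<Rightarrow> real" where
  "F_star m n a b f = Sup (multilinear_ext n f ` polytope m n a b 1 {..<n})"

definition approx_oracle :: "nat \<Rightarrow> nat \<Rightarrow> (nat \<Rightarrow> nat \<Rightarrow> real) \<Rightarrow> (nat \<Rightarrow> real) \<Rightarrow> (nat set \<Rightarrow> real) \<Rightarrow> real \<Rightarrow> (nat \<Rightarrow> nat set \<Rightarrow> nat \<Rightarrow> real) \<Rightarrow> bool" where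
  "approx_oracle m n a b f \<alpha> orc \<longleftrightarrow>
     (\<forall>l S. 1 \<le> l \<longrightarrow> l \<le> n \<longrightarrow> S \<subseteq> {..<n} \<longrightarrow>
        orc l S \<in> polytope m n a b (real l / real n) S \<and>
        multilinear_ext n f (orc l S) \<ge>
          \<alpha> * Sup (multilinear_ext n f ` polytope m n a b (real l / real n) S))"

text \<open>One round l (1-based) of Algorithm 3 with sampling phase: the arrival order is the
  permutation sigma (item sigma (l-1) arrives in round l); Y is the set of accepted items
  (y = ind_vec Y). Rounds l <= p n reject; later rounds follow Algorithm 3, with S the set of
  all items arrived so far (including the current one).\<close>
definition alg_step :: "nat \<Rightarrow> nat \<Rightarrow> (nat \<Rightarrow> nat \<Rightarrow> real) \<Rightarrow> (nat \<Rightarrow> real) \<Rightarrow> (nat \<Rightarrow> nat set \<Rightarrow> nat \<Rightarrow> real) \<Rightarrow> real \<Rightarrow> (nat \<Rightarrow> nat) \<Rightarrow> nat set \<Rightarrow> nat \<Rightarrow> nat set pmf" where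
  "alg_step m n a b orc p \<sigma> Y l =
     (if real l \<le> p * real n then return_pmf Y
      else (let j = \<sigma> (l - 1); xt = orc l (\<sigma> ` {..<l}) in
            map_pmf (\<lambda>c. if c \<and> packing_ok m n a b (ind_vec (insert j Y)) then insert j Y else Y)
                    (bernoulli_pmf (xt j))))"

definition alg_run :: "nat \<Rightarrow> nat \<Rightarrow> (nat \<Rightarrow> nat \<Rightarrow> real) \<Rightarrow> (nat \<Rightarrow> real) \<Rightarrow> (nat \<Rightarrow> nat set \<Rightarrow> nat \<Rightarrow> real) \<Rightarrow> real \<Rightarrow> (nat \<Rightarrow> nat) \<Rightarrow> nat set pmf" where
  "alg_run m n a b orc p \<sigma> =
     foldl (\<lambda>M l. bind_pmf M (\<lambda>Y. alg_step m n a b orc p \<sigma> Y l)) (return_pmf {}) [1..<Suc n]"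

definition alg_output :: "nat \<Rightarrow> nat \<Rightarrow> (nat \<Rightarrow> nat \<Rightarrow> real) \<Rightarrow> (nat \<Rightarrow> real) \<Rightarrow> (nat \<Rightarrow> nat set \<Rightarrow> nat \<Rightarrow> real) \<Rightarrow> real \<Rightarrow> nat set pmf" where
  "alg_output m n a b orc p =
     bind_pmf (pmf_of_set {\<sigma>. \<sigma> permutes {..<n}}) (alg_run m n a b orc p)"

definition sample_frac :: "nat \<Rightarrow> real \<Rightarrow> real" where
  "sample_frac d B = 1 - (1 / (2 * exp 1)) * (1 / (2 * real d)) powr (1 / (B - 1))"

end

theory Submission
  imports Defs
begin

text \<open>The random order is generated backwards: given the set \<open>T\<close> of the first \<open>l\<close> items, the item of
  round \<open>l\<close> is uniform in \<open>T\<close>. Conditioned on everything that happens from round \<open>l\<close> on, each earlier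
  round after the sampling phase tentatively consumes at most \<open>b i / n\<close> of resource \<open>i\<close> in
  expectation, so a Chernoff bound and a union bound over the at most \<open>d\<close> rows that the current item
  uses show that it fits with probability at least \<open>1/2\<close>. Its marginal gain is measured against
  the set \<open>W\<close> of items tentatively selected in later rounds, hence is fixed by that
  conditioning and, by submodularity, a lower bound for the true gain. In expectation the gain is at
  least \<open>(F x - f W) / l\<close>, where \<open>x\<close> is the oracle's solution in round \<open>l\<close>, and for a feasible
  \<open>z\<close> restricted to \<open>T\<close> one has \<open>F x \<ge> \<alpha> (l / n) F (z|T)\<close>. Solving the resulting recursion,
  with \<open>k\<close> the number of sampling rounds, gives the value \<open>\<alpha>/2 (k/n) (1 - k/n) F z\<close>.\<close>

section \<open>The multilinear extension\<close>

text \<open>For \<open>x\<close> in the unit cube this is the expectation of \<open>f\<close> at a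
  random set that contains each \<open>i\<close> in \<open>A\<close> independently with probability
  \<open>x i\<close>. A variable ground set allows induction on \<open>A\<close> and nesting one
  extension inside another.\<close>

definition mext :: "'a set \<Rightarrow> ('a \<Rightarrow> real) \<Rightarrow> ('a set \<Rightarrow> real) \<Rightarrow> real" where
  "mext A x f = (\<Sum>R\<in>Pow A. f R * (\<Prod>i\<in>R. x i) * (\<Prod>i\<in>A - R. 1 - x i))"

lemma multilinear_ext_eq_mext: "multilinear_ext n f x = mext {..<n} x f"
  by (simp add: multilinear_ext_def mext_def)

lemma mext_empty [simp]: "mext {} x f = f {}"
  by (simp add: mext_def)

text \<open>Condition on whether the random set contains \<open>a\<close>.\<close>

lemma mext_insert:
  assumes "finite A" "a \<notin> A"
  shows "mext (insert a A) x f = x a * mext A x (\<lambda>R. f (insert a R)) + (1 - x a) * mext A x f"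
proof -
  let ?t = "\<lambda>R. f R * (\<Prod>i\<in>R. x i) * (\<Prod>i\<in>insert a A - R. 1 - x i)"
  have "mext (insert a A) x f = sum ?t (Pow A) + sum ?t (insert a ` Pow A)"
    unfolding mext_def Pow_insert using assms by (intro sum.union_disjoint) auto
  also have "sum ?t (insert a ` Pow A) = (\<Sum>R\<in>Pow A. ?t (insert a R))"
    using assms by (subst sum.reindex) (auto simp: inj_on_def)
  also have "\<dots> = x a * mext A x (\<lambda>R. f (insert a R))"
    unfolding mext_def sum_distrib_left
  proof (rule sum.cong)
    fix R assume "R \<in> Pow A"
    then have "a \<notin> R" "finite R" "insert a A - insert a R = A - R"
      using assms finite_subset by auto
    then show "?t (insert a R) = x a * (f (insert a R) * (\<Prod>i\<in>R. x i) * (\<Prod>i\<in>A - R. 1 - x i))"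
      by simp
  qed simp
  also have "sum ?t (Pow A) = (1 - x a) * mext A x f"
    unfolding mext_def sum_distrib_left
  proof (rule sum.cong)
    fix R assume "R \<in> Pow A"
    then have "insert a A - R = insert a (A - R)" "a \<notin> A - R" "finite (A - R)"
      using assms finite_subset by auto
    then show "?t R = (1 - x a) * (f R * (\<Prod>i\<in>R. x i) * (\<Prod>i\<in>A - R. 1 - x i))"
      by simp
  qed simp
  finally show ?thesis by simp
qed

lemma mext_cong:
  assumes "\<And>R. R \<subseteq> A \<Longrightarrow> f R = g R"
  shows "mext A x f = mext A x g"
  unfolding mext_def using assms by (intro sum.cong) auto

lemma mext_mono:
  assumes "\<And>i. i \<in> A \<Longrightarrow> 0 \<le> x i \<and> x i \<le> 1" "\<And>R. R \<subseteq> A \<Longrightarrow> f R \<le> g R"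
  shows "mext A x f \<le> mext A x g"
  unfolding mext_def
proof (rule sum_mono)
  fix R assume R: "R \<in> Pow A"
  have "0 \<le> (\<Prod>i\<in>R. x i)" "0 \<le> (\<Prod>i\<in>A - R. 1 - x i)"
    using assms(1) R by (auto intro!: prod_nonneg)
  moreover have "f R \<le> g R" using assms(2) R by auto
  ultimately show "f R * (\<Prod>i\<in>R. x i) * (\<Prod>i\<in>A - R. 1 - x i)
      \<le> g R * (\<Prod>i\<in>R. x i) * (\<Prod>i\<in>A - R. 1 - x i)"
    by (intro mult_right_mono)
qed

lemma mext_add: "mext A x (\<lambda>R. f R + g R) = mext A x f + mext A x g"
  by (simp add: mext_def sum.distrib distrib_right)

lemma mext_cmult: "mext A x (\<lambda>R. c * f R) = c * mext A x f"
  by (simp add: mext_def sum_distrib_left mult.assoc)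

lemma mext_sum: "mext A x (\<lambda>R. \<Sum>j\<in>J. f j R) = (\<Sum>j\<in>J. mext A x (f j))"
  unfolding mext_def sum_distrib_right by (rule sum.swap)

lemma mext_const [simp]:
  assumes "finite A"
  shows "mext A x (\<lambda>R. c) = c"
  using assms by (induction A) (auto simp: mext_insert algebra_simps)

lemma mext_modular:
  assumes "finite A"
  shows "mext A x (\<lambda>R. c + sum g R) = c + (\<Sum>j\<in>A. x j * g j)"
  using assms
proof (induction A)
  case (insert a A)
  have "mext A x (\<lambda>R. c + sum g (insert a R)) = mext A x (\<lambda>R. (c + sum g R) + g a)"
    using insert by (intro mext_cong) (subst sum.insert, auto dest: finite_subset)
  also have "\<dots> = mext A x (\<lambda>R. c + sum g R) + mext A x (\<lambda>R. g a)"
    by (rule mext_add)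
  also have "\<dots> = c + (\<Sum>j\<in>A. x j * g j) + g a"
    using insert by simp
  finally show ?case using insert by (simp add: mext_insert algebra_simps)
qed simp

text \<open>Two-stage sampling: draw \<open>R\<close> according to \<open>x\<close>, then thin it
  according to \<open>w\<close>.\<close>

lemma mext_mult:
  assumes "finite A"
  shows "mext A (\<lambda>i. x i * w i) f = mext A x (\<lambda>R. mext R w f)"
  using assms
proof (induction A arbitrary: f)
  case (insert a A)
  have "mext A x (\<lambda>R. mext (insert a R) w f) =
      mext A x (\<lambda>R. w a * mext R w (\<lambda>R. f (insert a R)) + (1 - w a) * mext R w f)"
    using insert by (intro mext_cong mext_insert) (auto dest: finite_subset)
  also have "\<dots> = w a * mext A (\<lambda>i. x i * w i) (\<lambda>R. f (insert a R))
      + (1 - w a) * mext A (\<lambda>i. x i * w i) f"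
    by (simp only: mext_add mext_cmult insert.IH)
  finally have 1: "mext A x (\<lambda>R. mext (insert a R) w f) = \<dots>" .
  show ?case
    unfolding mext_insert[OF insert(1,2)] 1 insert.IH[symmetric] by (simp add: algebra_simps)
qed simp

lemma mext_indicator:
  assumes "finite A"
  shows "mext A (\<lambda>i. if i \<in> T then 1 else 0) f = f (A \<inter> T)"
  using assms by (induction A arbitrary: f) (auto simp: mext_insert Int_insert_left)

lemma mext_restrict:
  assumes "finite A"
  shows "mext A (\<lambda>i. if i \<in> T then x i else 0) f = mext A x (\<lambda>R. f (R \<inter> T))"
proof -
  have "mext A (\<lambda>i. if i \<in> T then x i else 0) f = mext A (\<lambda>i. x i * (if i \<in> T then 1 else 0)) f"
    by (intro arg_cong[where f = "\<lambda>x. mext A x f"]) auto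
  also have "\<dots> = mext A x (\<lambda>R. f (R \<inter> T))"
    unfolding mext_mult[OF assms] using assms
    by (intro mext_cong mext_indicator) (auto dest: finite_subset)
  finally show ?thesis .
qed

section \<open>Monotone submodular functions\<close>

text \<open>Diminishing returns for every \<open>j\<close>, including \<open>j \<in> B\<close>:
  there the left side is 0 and monotonicity makes the right side nonnegative.\<close>

lemma marginal_antimono:
  assumes "submodular_set_fun U f" "A \<subseteq> B" "B \<subseteq> U" "j \<in> U" "monotone_set_fun U f"
  shows "f (insert j B) - f B \<le> f (insert j A) - f A"
proof (cases "j \<in> B")
  case True
  have "f A \<le> f (insert j A)"
    using assms unfolding monotone_set_fun_def by (meson insert_subset order_trans subset_insertI)
  with True show ?thesis by (simp add: insert_absorb)
next
  case False
  then have "insert j A \<union> B = insert j B" "insert j A \<inter> B = A" using assms by auto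
  moreover have "insert j A \<subseteq> U" using assms by auto
  ultimately show ?thesis
    using assms(1)[unfolded submodular_set_fun_def, rule_format, of "insert j A" B] assms(3) by auto
qed

lemma union_le_sum_marginals:
  assumes "submodular_set_fun U f" "monotone_set_fun U f" "finite R" "R \<subseteq> U" "W \<subseteq> U"
  shows "f (R \<union> W) \<le> f W + (\<Sum>j\<in>R. f (insert j W) - f W)"
  using assms(3,4)
proof (induction R)
  case (insert j R)
  have "f (insert j (R \<union> W)) - f (R \<union> W) \<le> f (insert j W) - f W"
    using insert assms by (intro marginal_antimono[of U]) auto
  with insert show ?case by simp
qed simp

text \<open>Turns the value of a fractional point into the linear quantity that rounding collects,
  the expected marginal gains on top of \<open>W\<close>. For each outcome \<open>R\<close>, pass to
  \<open>R \<union> W\<close>; the resulting bound is modular in \<open>R\<close>.\<close>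

lemma mext_le_sum_marginals:
  assumes "submodular_set_fun U f" "monotone_set_fun U f" "finite U" "W \<subseteq> U"
    and "\<And>i. i \<in> U \<Longrightarrow> 0 \<le> x i \<and> x i \<le> 1"
  shows "mext U x f \<le> f W + (\<Sum>j\<in>U. x j * (f (insert j W) - f W))"
proof -
  have "mext U x f \<le> mext U x (\<lambda>R. f W + (\<Sum>j\<in>R. f (insert j W) - f W))"
  proof (rule mext_mono)
    fix R assume R: "R \<subseteq> U"
    have "f R \<le> f (R \<union> W)" using assms R unfolding monotone_set_fun_def by auto
    also have "\<dots> \<le> f W + (\<Sum>j\<in>R. f (insert j W) - f W)"
      using assms R by (intro union_le_sum_marginals) (auto dest: finite_subset)
    finally show "f R \<le> f W + (\<Sum>j\<in>R. f (insert j W) - f W)" .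
  qed (use assms in auto)
  also have "\<dots> = f W + (\<Sum>j\<in>U. x j * (f (insert j W) - f W))"
    using assms by (intro mext_modular)
  finally show ?thesis .
qed

text \<open>Add the elements one at a time: a new \<open>a\<close> is sampled with probability
  \<open>t\<close> and then gains at least its marginal value on top of all of
  \<open>A\<close>.\<close>

lemma subsample_ge:
  assumes "submodular_set_fun U f" "monotone_set_fun U f" "finite A" "A \<subseteq> U"
    and "0 \<le> t" "t \<le> (1::real)"
  shows "mext A (\<lambda>_. t) f \<ge> t * f A + (1 - t) * f {}"
  using assms(3,4)
proof (induction A)
  case (insert a A)
  have "mext A (\<lambda>_. t) (\<lambda>R. f R + (f (insert a A) - f A)) \<le> mext A (\<lambda>_. t) (\<lambda>R. f (insert a R))"
  proof (rule mext_mono)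
    fix R assume "R \<subseteq> A"
    then have "f (insert a A) - f A \<le> f (insert a R) - f R"
      using insert assms by (intro marginal_antimono[of U]) auto
    then show "f R + (f (insert a A) - f A) \<le> f (insert a R)" by simp
  qed (use assms in auto)
  then have "t * (mext A (\<lambda>_. t) f + (f (insert a A) - f A)) \<le> t * mext A (\<lambda>_. t) (\<lambda>R. f (insert a R))"
    using insert assms by (intro mult_left_mono) (simp_all add: mext_add)
  moreover have "mext A (\<lambda>_. t) f \<ge> t * f A + (1 - t) * f {}"
    using insert by auto
  ultimately show ?case using insert by (simp add: mext_insert algebra_simps)
qed (simp add: algebra_simps)

text \<open>Scaling by \<open>t\<close> thins the random set drawn from \<open>x\<close>;
  \<open>subsample_ge\<close> applies to every outcome.\<close>

lemma mext_scale_ge: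
  assumes "submodular_set_fun U f" "monotone_set_fun U f" "finite U" "f {} \<ge> 0"
    and "\<And>i. i \<in> U \<Longrightarrow> 0 \<le> x i \<and> x i \<le> 1" and "0 \<le> t" "t \<le> (1::real)"
  shows "mext U (\<lambda>i. x i * t) f \<ge> t * mext U x f"
proof -
  have "t * mext U x f = mext U x (\<lambda>R. t * f R)" by (simp add: mext_cmult)
  also have "\<dots> \<le> mext U x (\<lambda>R. mext R (\<lambda>_. t) f)"
  proof (rule mext_mono)
    fix R assume "R \<subseteq> U"
    then have "t * f R + (1 - t) * f {} \<le> mext R (\<lambda>_. t) f"
      using assms by (intro subsample_ge) (auto dest: finite_subset)
    moreover have "(1 - t) * f {} \<ge> 0" using assms by simp
    ultimately show "t * f R \<le> mext R (\<lambda>_. t) f" by linarith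
  qed (use assms in auto)
  also have "\<dots> = mext U (\<lambda>i. x i * t) f"
    using assms by (simp add: mext_mult)
  finally show ?thesis .
qed

lemma sum_delete_ge:
  assumes "submodular_set_fun U f" "monotone_set_fun U f" "finite T" "A \<subseteq> T" "T \<subseteq> U"
    and "f {} \<ge> 0"
  shows "(\<Sum>j\<in>T. f (A - {j})) \<ge> (real (card T) - 1) * f A"
proof -
  have fin: "finite A" using assms finite_subset by blast
  \<comment> \<open>Deleting \<open>D\<close> element by element costs
    \<open>f A - f (A - D)\<close> in total, and each deletion from the shrinking set costs at least
    as much as the same deletion from \<open>A\<close>.\<close>
  have *: "(\<Sum>j\<in>D. f A - f (A - {j})) \<le> f A - f (A - D)" if "D \<subseteq> A" for D
  proof -
    have "finite D" using that fin finite_subset by blast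
    then show ?thesis using that
    proof (induction D)
      case (insert a D)
      have eq: "insert a (A - insert a D) = A - D" "insert a (A - {a}) = A" using insert by auto
      have "f (insert a (A - {a})) - f (A - {a}) \<le> f (insert a (A - insert a D)) - f (A - insert a D)"
        using insert assms by (intro marginal_antimono[of U]) auto
      with eq insert show ?case by simp
    qed simp
  qed
  have "(\<Sum>j\<in>T. f A - f (A - {j})) = (\<Sum>j\<in>A. f A - f (A - {j}))"
    using assms by (intro sum.mono_neutral_right) auto
  also have "\<dots> \<le> f A - f (A - A)" by (rule *) simp
  also have "\<dots> \<le> f A" using assms by simp
  finally show ?thesis by (simp add: sum_subtractf algebra_simps)
qed

text \<open>For \<open>card T = l + 1\<close>, deleting a uniformly random item of \<open>T\<close>
  keeps at least the fraction \<open>l / (l + 1)\<close> of the value on average. This controls the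
  benchmark when the last arrival is removed.\<close>

lemma mext_delete_ge:
  assumes "submodular_set_fun U f" "monotone_set_fun U f" "finite U" "T \<subseteq> U" "f {} \<ge> 0"
    and "\<And>i. i \<in> U \<Longrightarrow> 0 \<le> x i \<and> x i \<le> 1"
  shows "(\<Sum>j\<in>T. mext U x (\<lambda>R. f (R \<inter> (T - {j})))) \<ge>
    (real (card T) - 1) * mext U x (\<lambda>R. f (R \<inter> T))"
proof -
  have "(real (card T) - 1) * mext U x (\<lambda>R. f (R \<inter> T)) =
      mext U x (\<lambda>R. (real (card T) - 1) * f (R \<inter> T))"
    by (simp add: mext_cmult)
  also have "\<dots> \<le> mext U x (\<lambda>R. \<Sum>j\<in>T. f (R \<inter> (T - {j})))"
  proof (rule mext_mono)
    fix R assume "R \<subseteq> U"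
    have "R \<inter> (T - {j}) = R \<inter> T - {j}" for j by auto
    then show "(real (card T) - 1) * f (R \<inter> T) \<le> (\<Sum>j\<in>T. f (R \<inter> (T - {j})))"
      using sum_delete_ge[of U f T "R \<inter> T"] assms by (auto dest: finite_subset)
  qed (use assms in auto)
  also have "\<dots> = (\<Sum>j\<in>T. mext U x (\<lambda>R. f (R \<inter> (T - {j}))))" by (rule mext_sum)
  finally show ?thesis .
qed

section \<open>The algorithm, generated backwards in time\<close>

text \<open>In the reversed list the last arrival is the head, so removing the head goes back one
  round.\<close>

lemma map_rev_permutes:
  "map_pmf (\<lambda>\<sigma>. rev (map \<sigma> [0..<n])) (pmf_of_set {\<sigma>. \<sigma> permutes {..<n}}) =
    pmf_of_set (permutations_of_set {..<n})"
proof (rule map_pmf_of_set_bij_betw)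
  let ?g = "\<lambda>\<sigma>::nat \<Rightarrow> nat. rev (map \<sigma> [0..<n])"
  have inj: "inj_on ?g {\<sigma>. \<sigma> permutes {..<n}}"
  proof (rule inj_onI, rule ext)
    fix \<sigma> \<tau> :: "nat \<Rightarrow> nat" and x
    assume *: "\<sigma> \<in> {\<sigma>. \<sigma> permutes {..<n}}" "\<tau> \<in> {\<sigma>. \<sigma> permutes {..<n}}" "?g \<sigma> = ?g \<tau>"
    show "\<sigma> x = \<tau> x"
    proof (cases "x < n")
      case True
      with * show ?thesis by simp
    next
      case False
      with * show ?thesis by (simp add: permutes_not_in)
    qed
  qed
  have "?g ` {\<sigma>. \<sigma> permutes {..<n}} = permutations_of_set {..<n}"
  proof (rule card_subset_eq)
    show "?g ` {\<sigma>. \<sigma> permutes {..<n}} \<subseteq> permutations_of_set {..<n}"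
    proof clarify
      fix \<sigma> :: "nat \<Rightarrow> nat" assume \<sigma>: "\<sigma> permutes {..<n}"
      show "?g \<sigma> \<in> permutations_of_set {..<n}"
        using permutes_image[OF \<sigma>] permutes_inj_on[OF \<sigma>]
        by (intro permutations_of_setI) (auto simp: distinct_map lessThan_atLeast0)
    qed
    show "card (?g ` {\<sigma>. \<sigma> permutes {..<n}}) = card (permutations_of_set {..<n})"
      using inj by (simp add: card_image card_permutations)
  qed simp
  with inj show "bij_betw ?g {\<sigma>. \<sigma> permutes {..<n}} (permutations_of_set {..<n})"
    by (simp add: bij_betw_def)
  show "{\<sigma>. \<sigma> permutes {..<n}} \<noteq> {}" using permutes_id by blast
qed (simp add: finite_permutations)

lemma expectation_bind_finite:
  fixes h :: "'b \<Rightarrow> real"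
  assumes "finite (set_pmf P)" "\<And>x. finite (set_pmf (K x))"
  shows "measure_pmf.expectation (bind_pmf P K) h =
    measure_pmf.expectation P (\<lambda>x. measure_pmf.expectation (K x) h)"
proof -
  have "measure_pmf.expectation (bind_pmf P K) h =
      (\<Sum>x\<in>set_pmf P. pmf P x *\<^sub>R measure_pmf.expectation (K x) h)"
    using assms by (intro pmf_expectation_bind) auto
  also have "\<dots> = measure_pmf.expectation P (\<lambda>x. measure_pmf.expectation (K x) h)"
    using assms by (subst integral_measure_pmf[of "set_pmf P"]) auto
  finally show ?thesis .
qed

text \<open>\<open>k\<close> is the number of rejected rounds. The load estimates rest on the
  feasibility of the oracle's points; their value enters in
  \<open>submodular_packing\<close>.\<close>

locale online_packing =
  fixes n m k :: nat and a :: "nat \<Rightarrow> nat \<Rightarrow> real" and b :: "nat \<Rightarrow> real"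
    and orc :: "nat \<Rightarrow> nat set \<Rightarrow> nat \<Rightarrow> real"
  assumes a_nonneg: "\<And>i j. i < m \<Longrightarrow> j < n \<Longrightarrow> 0 \<le> a i j"
    and b_pos: "\<And>i. i < m \<Longrightarrow> 0 < b i"
    and orc_polytope: "\<And>l S. 1 \<le> l \<Longrightarrow> l \<le> n \<Longrightarrow> S \<subseteq> {..<n} \<Longrightarrow>
      orc l S \<in> polytope m n a b (real l / real n) S"
begin

abbreviation ok :: "nat set \<Rightarrow> bool" where
  "ok Y \<equiv> packing_ok m n a b (ind_vec Y)"

definition load :: "nat \<Rightarrow> nat set \<Rightarrow> real" where
  "load i Y = (\<Sum>j<n. a i j * ind_vec Y j)"

definition place :: "nat \<Rightarrow> nat set \<Rightarrow> nat set" where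
  "place j Y = (if ok (insert j Y) then insert j Y else Y)"

text \<open>The probability of tentative selection. The value 0 in the first \<open>k\<close> rounds
  makes the sampling phase a special case of the general round.\<close>

definition sel :: "nat \<Rightarrow> nat set \<Rightarrow> nat \<Rightarrow> real" where
  "sel l T j = (if l \<le> k then 0 else orc l T j)"

text \<open>The expectation of \<open>h\<close> at the set accepted after \<open>l\<close> rounds, given that \<open>T\<close> is the
  (\<open>l\<close>-element) set of items that arrived in them: the last of these items is uniform in \<open>T\<close>.\<close>
primrec mean :: "nat \<Rightarrow> nat set \<Rightarrow> (nat set \<Rightarrow> real) \<Rightarrow> real" where
  "mean 0 T h = h {}"
| "mean (Suc l) T h = (\<Sum>j\<in>T. mean l (T - {j})
     (\<lambda>Y. sel (Suc l) T j * h (place j Y) + (1 - sel (Suc l) T j) * h Y)) / real (Suc l)"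

section \<open>Loads, feasibility and the backward expectation as a monotone linear
  functional\<close>

lemma ok_iff: "ok Y \<longleftrightarrow> (\<forall>i<m. load i Y \<le> b i)"
  by (simp add: packing_ok_def load_def)

lemma ok_empty: "ok {}"
  using b_pos by (simp add: packing_ok_def ind_vec_def less_imp_le)

lemma ok_place: "ok Y \<Longrightarrow> ok (place j Y)"
  by (simp add: place_def)

lemma place_subset: "place j Y \<subseteq> insert j Y"
  by (auto simp: place_def)

lemma load_insert:
  assumes "j < n" "j \<notin> Y"
  shows "load i (insert j Y) = load i Y + a i j"
proof -
  have "load i (insert j Y) = (\<Sum>q<n. a i q * ind_vec Y q + (if q = j then a i j else 0))"
    unfolding load_def using assms by (intro sum.cong) (auto simp: ind_vec_def)
  also have "\<dots> = load i Y + a i j"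
    using assms by (simp add: sum.distrib load_def)
  finally show ?thesis .
qed

lemma sel_bounds:
  assumes "1 \<le> l" "l \<le> n" "T \<subseteq> {..<n}" "j < n"
  shows "0 \<le> sel l T j" "sel l T j \<le> 1"
  using orc_polytope[OF assms(1-3)] assms(4) by (auto simp: sel_def polytope_def)

lemma card_le_n: "T \<subseteq> {..<n} \<Longrightarrow> card T \<le> n"
  using card_mono[of "{..<n}" T] by simp

text \<open>Comparing at feasible subsets of \<open>T\<close> suffices because \<open>place\<close>
  never leaves them; selection probabilities in [0,1] keep all weights nonnegative.\<close>

lemma mean_mono:
  assumes "card T = l" "T \<subseteq> {..<n}" "\<And>Y. Y \<subseteq> T \<Longrightarrow> ok Y \<Longrightarrow> h Y \<le> h' Y"
  shows "mean l T h \<le> mean l T h'"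
  using assms
proof (induction l arbitrary: T h h')
  case 0
  then show ?case using ok_empty by simp
next
  case (Suc l)
  have "mean l (T - {j}) (\<lambda>Y. sel (Suc l) T j * h (place j Y) + (1 - sel (Suc l) T j) * h Y)
     \<le> mean l (T - {j}) (\<lambda>Y. sel (Suc l) T j * h' (place j Y) + (1 - sel (Suc l) T j) * h' Y)"
    if j: "j \<in> T" for j
  proof (rule Suc.IH)
    have s: "0 \<le> sel (Suc l) T j" "sel (Suc l) T j \<le> 1"
      using sel_bounds[of "Suc l" T j] Suc.prems j card_le_n[of T] by auto
    fix Y assume Y: "Y \<subseteq> T - {j}" "ok Y"
    have "h (place j Y) \<le> h' (place j Y)" "h Y \<le> h' Y"
      using Y j place_subset[of j Y] by (auto intro!: Suc.prems(3) ok_place)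
    then show "sel (Suc l) T j * h (place j Y) + (1 - sel (Suc l) T j) * h Y
      \<le> sel (Suc l) T j * h' (place j Y) + (1 - sel (Suc l) T j) * h' Y"
      using s by (intro add_mono mult_left_mono) auto
  qed (use Suc.prems j finite_subset[of T] in \<open>auto simp: card_Diff_singleton\<close>)
  then show ?case by (simp add: divide_right_mono sum_mono)
qed

lemma mean_cong:
  assumes "card T = l" "T \<subseteq> {..<n}" "\<And>Y. Y \<subseteq> T \<Longrightarrow> ok Y \<Longrightarrow> h Y = h' Y"
  shows "mean l T h = mean l T h'"
  using assms by (intro antisym mean_mono) auto

lemma mean_add: "mean l T (\<lambda>Y. h Y + h' Y) = mean l T h + mean l T h'"
proof (induction l arbitrary: T h h')
  case (Suc l)
  have "sel (Suc l) T j * (h (place j Y) + h' (place j Y)) + (1 - sel (Suc l) T j) * (h Y + h' Y)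
    = (sel (Suc l) T j * h (place j Y) + (1 - sel (Suc l) T j) * h Y) +
      (sel (Suc l) T j * h' (place j Y) + (1 - sel (Suc l) T j) * h' Y)" for j Y
    by (simp add: algebra_simps)
  then show ?case by (simp add: Suc.IH sum.distrib add_divide_distrib)
qed simp

lemma mean_cmult: "mean l T (\<lambda>Y. c * h Y) = c * mean l T h"
proof (induction l arbitrary: T h)
  case (Suc l)
  have "sel (Suc l) T j * (c * h (place j Y)) + (1 - sel (Suc l) T j) * (c * h Y)
    = c * (sel (Suc l) T j * h (place j Y) + (1 - sel (Suc l) T j) * h Y)" for j Y
    by (simp add: algebra_simps)
  then show ?case by (simp add: Suc.IH flip: sum_distrib_left)
qed simp

lemma mean_sum: "mean l T (\<lambda>Y. \<Sum>i\<in>I. h i Y) = (\<Sum>i\<in>I. mean l T (h i))"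
proof (induction I rule: infinite_finite_induct)
  case empty
  show ?case using mean_cmult[of l T 0 "\<lambda>_. 0"] by simp
next
  case (infinite I)
  then show ?case using mean_cmult[of l T 0 "\<lambda>_. 0"] by simp
qed (simp add: mean_add)

lemma mean_const:
  assumes "card T = l" "finite T"
  shows "mean l T (\<lambda>_. c) = c"
  using assms
proof (induction l arbitrary: T)
  case (Suc l)
  have "sel (Suc l) T j * c + (1 - sel (Suc l) T j) * c = c" for j
    by (simp add: algebra_simps)
  moreover have "mean l (T - {j}) (\<lambda>_. c) = c" if "j \<in> T" for j
    using Suc that by (simp add: card_Diff_singleton)
  ultimately show ?case using Suc.prems by (simp add: divide_simps)
qed simp

subsection \<open>The expectation of the algorithm's output\<close>

definition step :: "real \<Rightarrow> nat \<Rightarrow> nat set \<Rightarrow> nat \<Rightarrow> nat set \<Rightarrow> nat set pmf" where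
  "step p l T j Y = (if real l \<le> p * real n then return_pmf Y
     else map_pmf (\<lambda>c. if c \<and> ok (insert j Y) then insert j Y else Y) (bernoulli_pmf (orc l T j)))"

text \<open>The items are listed in reverse order of arrival.\<close>
primrec rev_run :: "real \<Rightarrow> nat list \<Rightarrow> nat set pmf" where
  "rev_run p [] = return_pmf {}"
| "rev_run p (j # js) =
     bind_pmf (rev_run p js) (step p (Suc (length js)) (set (j # js)) j)"

lemma alg_run_eq_rev_run: "alg_run m n a b orc p \<sigma> = rev_run p (rev (map \<sigma> [0..<n]))"
proof -
  \<comment> \<open>Generalized to the first \<open>q\<close> rounds for the induction; item
    \<open>\<sigma> q\<close> arrives in round \<open>q + 1\<close>.\<close>
  have "foldl (\<lambda>M l. bind_pmf M (\<lambda>Y. alg_step m n a b orc p \<sigma> Y l)) (return_pmf {}) [1..<Suc q]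
     = rev_run p (rev (map \<sigma> [0..<q]))" for q
  proof (induction q)
    case (Suc q)
    have "insert (\<sigma> q) (\<sigma> ` {0..<q}) = \<sigma> ` {..<Suc q}"
      by (auto simp: less_Suc_eq)
    moreover have "alg_step m n a b orc p \<sigma> Y (Suc q) =
        step p (Suc q) (\<sigma> ` {..<Suc q}) (\<sigma> q) Y" for Y
      by (simp add: alg_step_def step_def Let_def)
    moreover have "[1..<Suc (Suc q)] = [1..<Suc q] @ [Suc q]" by simp
    moreover have "rev (map \<sigma> [0..<Suc q]) = \<sigma> q # rev (map \<sigma> [0..<q])" by simp
    ultimately show ?case
      using Suc.IH by (simp del: upt_Suc)
  qed simp
  then show ?thesis by (simp add: alg_run_def)
qed

lemma alg_output_eq_rev_run:
  "alg_output m n a b orc p = bind_pmf (pmf_of_set (permutations_of_set {..<n})) (rev_run p)"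
proof -
  have "alg_run m n a b orc p = (\<lambda>\<sigma>. rev_run p (rev (map \<sigma> [0..<n])))"
    by (rule ext) (rule alg_run_eq_rev_run)
  then show ?thesis
    by (simp only: alg_output_def bind_map_pmf flip: map_rev_permutes)
qed

lemma set_rev_run: "Y \<in> set_pmf (rev_run p js) \<Longrightarrow> ok Y \<and> Y \<subseteq> set js"
proof (induction js arbitrary: Y)
  case (Cons j js)
  then obtain Z where "Z \<in> set_pmf (rev_run p js)"
    "Y \<in> set_pmf (step p (Suc (length js)) (set (j # js)) j Z)" by auto
  with Cons.IH[of Z] show ?case
    by (fastforce simp: step_def split: if_splits)
qed (simp add: ok_empty)

lemma finite_rev_run: "finite (set_pmf (rev_run p js))"
proof (rule finite_subset)
  show "set_pmf (rev_run p js) \<subseteq> Pow (set js)" using set_rev_run by blast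
qed simp

lemma ok_alg_output:
  assumes "Y \<in> set_pmf (alg_output m n a b orc p)"
  shows "ok Y"
  using assms set_rev_run unfolding alg_output_eq_rev_run set_bind_pmf by blast

lemma finite_step: "finite (set_pmf (step p l T j Y))"
  by (simp add: step_def)

lemma expectation_step:
  assumes "1 \<le> l" "l \<le> n" "T \<subseteq> {..<n}" "j < n" "\<And>l. real l \<le> p * real n \<longleftrightarrow> l \<le> k"
  shows "measure_pmf.expectation (step p l T j Y) h =
    sel l T j * h (place j Y) + (1 - sel l T j) * (h Y :: real)"
proof (cases "l \<le> k")
  case True
  then show ?thesis using assms(5)[of l] by (simp add: step_def sel_def)
next
  case False
  have "0 \<le> orc l T j" "orc l T j \<le> 1"
    using sel_bounds[OF assms(1-4)] False by (simp_all add: sel_def)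
  with False assms(5)[of l] show ?thesis
    by (simp add: step_def sel_def place_def)
qed

text \<open>A uniform permutation of \<open>T\<close> is a uniform head followed by a uniform
  permutation of the rest. The head is the last arrival, so this matches the recursion of
  \<open>mean\<close>.\<close>

lemma expectation_rev_run:
  assumes "card T = l" "T \<subseteq> {..<n}" "\<And>l. real l \<le> p * real n \<longleftrightarrow> l \<le> k"
  shows "measure_pmf.expectation (bind_pmf (pmf_of_set (permutations_of_set T)) (rev_run p)) h
    = mean l T h"
  using assms
proof (induction l arbitrary: T h)
  case 0
  then have "T = {}" using finite_subset by fastforce
  then show ?case by (simp add: pmf_of_set_singleton bind_return_pmf)
next
  case (Suc l)
  let ?Q = "\<lambda>T. bind_pmf (pmf_of_set (permutations_of_set T)) (rev_run p)"
  have fin: "finite T" "T \<noteq> {}" using Suc.prems finite_subset by auto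
  have finQ: "finite (set_pmf (?Q S))" if "finite S" for S
    using that finite_rev_run by (auto simp: set_pmf_of_set)
  have "?Q T = bind_pmf (pmf_of_set T) (\<lambda>j. bind_pmf (pmf_of_set (permutations_of_set (T - {j})))
     (\<lambda>js. rev_run p (j # js)))"
    unfolding random_permutation_of_set[OF fin] by (simp add: bind_assoc_pmf bind_return_pmf)
  also have "\<dots> = bind_pmf (pmf_of_set T) (\<lambda>j. bind_pmf (?Q (T - {j})) (step p (Suc l) T j))"
  proof (rule bind_pmf_cong[OF refl])
    fix j assume "j \<in> set_pmf (pmf_of_set T)"
    then have j: "j \<in> T" using fin by (simp add: set_pmf_of_set)
    have "bind_pmf (pmf_of_set (permutations_of_set (T - {j}))) (\<lambda>js. rev_run p (j # js)) =
      bind_pmf (pmf_of_set (permutations_of_set (T - {j})))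
        (\<lambda>js. bind_pmf (rev_run p js) (step p (Suc l) T j))"
    proof (rule bind_pmf_cong[OF refl])
      fix js assume "js \<in> set_pmf (pmf_of_set (permutations_of_set (T - {j})))"
      then have js: "js \<in> permutations_of_set (T - {j})" using fin by (simp add: set_pmf_of_set)
      then have "length js = l" "set (j # js) = T"
        using length_finite_permutations_of_set[OF js] permutations_of_setD(1)[OF js] Suc.prems fin j
        by (auto simp: card_Diff_singleton)
      then show "rev_run p (j # js) = bind_pmf (rev_run p js) (step p (Suc l) T j)"
        by simp
    qed
    then show "bind_pmf (pmf_of_set (permutations_of_set (T - {j}))) (\<lambda>js. rev_run p (j # js)) =
      bind_pmf (?Q (T - {j})) (step p (Suc l) T j)"
      by (simp add: bind_assoc_pmf)
  qed
  finally have Q: "?Q T = \<dots>" .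
  have "measure_pmf.expectation (?Q T) h = (\<Sum>j\<in>T.
      measure_pmf.expectation (bind_pmf (?Q (T - {j})) (step p (Suc l) T j)) h /\<^sub>R real (card T))"
    unfolding Q
  proof (rule pmf_expectation_bind_pmf_of_set)
    show "finite (set_pmf (bind_pmf (?Q (T - {j})) (step p (Suc l) T j)))" for j
      using fin finQ[of "T - {j}"] finite_step by (simp only: set_bind_pmf) blast
  qed (use fin in auto)
  also have "\<dots> = (\<Sum>j\<in>T.
      measure_pmf.expectation (bind_pmf (?Q (T - {j})) (step p (Suc l) T j)) h) / real (card T)"
    by (simp add: divide_inverse_commute flip: sum_distrib_left)
  also have "\<dots> = mean (Suc l) T h"
  proof -
    have "measure_pmf.expectation (bind_pmf (?Q (T - {j})) (step p (Suc l) T j)) h =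
      mean l (T - {j}) (\<lambda>Y. sel (Suc l) T j * h (place j Y) + (1 - sel (Suc l) T j) * h Y)"
      if j: "j \<in> T" for j
    proof -
      have step: "measure_pmf.expectation (step p (Suc l) T j Y) h =
          sel (Suc l) T j * h (place j Y) + (1 - sel (Suc l) T j) * h Y" for Y
      proof (rule expectation_step)
        show "Suc l \<le> n" using card_le_n[OF Suc.prems(2)] Suc.prems(1) by simp
        show "j < n" using Suc.prems(2) j by auto
      qed (simp, rule Suc.prems(2), rule Suc.prems(3))
      have "measure_pmf.expectation (bind_pmf (?Q (T - {j})) (step p (Suc l) T j)) h =
        measure_pmf.expectation (?Q (T - {j}))
          (\<lambda>Y. measure_pmf.expectation (step p (Suc l) T j Y) h)"
        using finQ[of "T - {j}"] fin finite_step
        by (intro expectation_bind_finite) (blast intro: finite_Diff)+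
      also have "\<dots> = mean l (T - {j})
          (\<lambda>Y. sel (Suc l) T j * h (place j Y) + (1 - sel (Suc l) T j) * h Y)"
        unfolding step
      proof (rule Suc.IH)
        show "card (T - {j}) = l" using Suc.prems(1) j fin by (simp add: card_Diff_singleton)
        show "T - {j} \<subseteq> {..<n}" using Suc.prems(2) by auto
      qed (rule Suc.prems(3))
      finally show ?thesis .
    qed
    then show ?thesis using Suc.prems(1) by simp
  qed
  finally show ?case .
qed

end

section \<open>Feasibility of a tentatively selected item\<close>

text \<open>By convexity \<open>exp\<close> lies below its chord between 0 and
  \<open>c\<close>.\<close>

lemma exp_mult_le_chord:
  fixes u c :: real
  assumes "0 \<le> u" "u \<le> 1"
  shows "exp (u * c) \<le> 1 + u * (exp c - 1)"
  using convex_onD[OF exp_convex assms, of 0 c] by (simp add: algebra_simps)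

context online_packing
begin

lemma load_place_le:
  assumes "i < m" "j < n" "j \<notin> Y"
  shows "load i (place j Y) \<le> load i Y + a i j"
  using load_insert[OF assms(2,3), of i] a_nonneg[OF assms(1,2)] by (simp add: place_def)

text \<open>The oracle's point respects capacities scaled by \<open>l / n\<close>. Averaging over
  the \<open>l\<close> possible last arrivals therefore gives expected consumption at most
  \<open>b i / n\<close>.\<close>

lemma sum_sel_le:
  assumes "k < l" "l \<le> n" "T \<subseteq> {..<n}" "i < m"
  shows "(\<Sum>j\<in>T. a i j * sel l T j) \<le> real l / real n * b i"
proof -
  have x: "orc l T \<in> polytope m n a b (real l / real n) T"
    using assms by (intro orc_polytope) auto
  have "(\<Sum>j\<in>T. a i j * sel l T j) \<le> (\<Sum>j<n. a i j * orc l T j)"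
    using assms x a_nonneg
    by (simp add: sel_def, intro sum_mono2) (auto simp: polytope_def)
  also have "\<dots> \<le> real l / real n * b i"
    using x assms(4) by (simp add: polytope_def)
  finally show ?thesis .
qed

text \<open>Chernoff moment bound without independence: the one-round estimate holds for every
  arrived set \<open>T\<close>, so each round after sampling contributes one fixed factor.\<close>

lemma mean_exp_load_le:
  assumes "card T = l" "T \<subseteq> {..<n}" "i < m" "0 < M" "\<And>j. j < n \<Longrightarrow> a i j \<le> M" "0 \<le> \<theta>"
  shows "mean l T (\<lambda>Y. exp (\<theta> * load i Y))
    \<le> exp (real (l - k) * (b i / (real n * M) * (exp (\<theta> * M) - 1)))"
  using assms(1,2)
proof (induction l arbitrary: T)
  case 0
  then show ?case by (simp add: load_def ind_vec_def)
next
  case (Suc l)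
  define c where "c = exp (\<theta> * M) - 1"
  define E where "E = exp (real (l - k) * (b i / (real n * M) * c))"
  have c: "0 \<le> c" using assms by (simp add: c_def)
  have fin: "finite T" using Suc.prems finite_subset by auto
  have n: "Suc l \<le> n" using card_le_n[OF Suc.prems(2)] Suc.prems(1) by simp
  let ?s = "sel (Suc l) T"
  have step: "mean l (T - {j}) (\<lambda>Y. ?s j * exp (\<theta> * load i (place j Y)) + (1 - ?s j) * exp (\<theta> * load i Y))
    \<le> (1 + ?s j * (a i j / M * c)) * E" if j: "j \<in> T" for j
  proof -
    have jn: "j < n" using j Suc.prems by auto
    have s: "0 \<le> ?s j" using sel_bounds[of "Suc l" T j] n Suc.prems jn by auto
    have a: "0 \<le> a i j" "a i j \<le> M" using a_nonneg assms jn by auto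
    have card: "card (T - {j}) = l" using Suc.prems(1) j fin by (simp add: card_Diff_singleton)
    have "mean l (T - {j}) (\<lambda>Y. ?s j * exp (\<theta> * load i (place j Y)) + (1 - ?s j) * exp (\<theta> * load i Y))
      \<le> mean l (T - {j}) (\<lambda>Y. (1 + ?s j * (a i j / M * c)) * exp (\<theta> * load i Y))"
    proof (rule mean_mono)
      fix Y assume Y: "Y \<subseteq> T - {j}"
      \<comment> \<open>The chord bound with \<open>u = a i j / M\<close> makes the factor linear in
        \<open>a i j\<close>, so that averaging over \<open>T\<close> produces the sum bounded by
        \<open>sum_sel_le\<close>.\<close>
      have "exp (\<theta> * load i (place j Y)) \<le> exp (\<theta> * (load i Y + a i j))"
        using load_place_le[of i j Y] assms jn Y by (auto intro: mult_left_mono)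
      also have "\<dots> = exp (\<theta> * load i Y) * exp (a i j / M * (\<theta> * M))"
        using assms(4) by (simp add: exp_add distrib_left mult.commute)
      also have "\<dots> \<le> exp (\<theta> * load i Y) * (1 + a i j / M * c)"
        unfolding c_def using a assms(4) by (intro mult_left_mono exp_mult_le_chord) auto
      finally have "?s j * exp (\<theta> * load i (place j Y)) \<le>
          ?s j * (exp (\<theta> * load i Y) * (1 + a i j / M * c))"
        using s by (rule mult_left_mono)
      then show "?s j * exp (\<theta> * load i (place j Y)) + (1 - ?s j) * exp (\<theta> * load i Y) \<le>
        (1 + ?s j * (a i j / M * c)) * exp (\<theta> * load i Y)"
        by (simp add: algebra_simps)
    qed (use card Suc.prems in auto)
    also have "\<dots> = (1 + ?s j * (a i j / M * c)) * mean l (T - {j}) (\<lambda>Y. exp (\<theta> * load i Y))"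
      by (rule mean_cmult)
    also have "\<dots> \<le> (1 + ?s j * (a i j / M * c)) * E"
    proof (rule mult_left_mono)
      show "mean l (T - {j}) (\<lambda>Y. exp (\<theta> * load i Y)) \<le> E"
        unfolding E_def c_def using card Suc.prems by (intro Suc.IH) auto
      show "0 \<le> 1 + ?s j * (a i j / M * c)"
        using s a c assms(4) by (intro add_nonneg_nonneg mult_nonneg_nonneg) auto
    qed
    finally show ?thesis .
  qed
  have "mean (Suc l) T (\<lambda>Y. exp (\<theta> * load i Y)) \<le>
      (\<Sum>j\<in>T. (1 + ?s j * (a i j / M * c)) * E) / real (Suc l)"
    unfolding mean.simps by (intro divide_right_mono sum_mono step) auto
  also have "\<dots> = (1 + c / M * ((\<Sum>j\<in>T. a i j * ?s j) / real (Suc l))) * E"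
  proof -
    have "(\<Sum>j\<in>T. (1 + ?s j * (a i j / M * c)) * E) = (real (Suc l) + c / M * (\<Sum>j\<in>T. a i j * ?s j)) * E"
      using Suc.prems(1)
      by (simp add: sum.distrib sum_distrib_left flip: sum_distrib_right) (simp add: mult_ac)
    then show ?thesis by (simp add: divide_simps)
  qed
  also have "\<dots> \<le> exp (real (Suc l - k) * (b i / (real n * M) * c))"
  proof (cases "Suc l \<le> k")
    case True
    \<comment> \<open>In the sampling phase nothing is selected, and truncated subtraction makes
      both exponents 0.\<close>
    then show ?thesis by (simp add: sel_def E_def)
  next
    case False
    have "(\<Sum>j\<in>T. a i j * ?s j) / real (Suc l) \<le> (real (Suc l) / real n * b i) / real (Suc l)"
      using False n Suc.prems assms(3) by (intro divide_right_mono sum_sel_le) auto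
    also have "\<dots> = b i / real n" by simp
    finally have "c / M * ((\<Sum>j\<in>T. a i j * ?s j) / real (Suc l)) \<le> c / M * (b i / real n)"
      using c assms(4) by (intro mult_left_mono) auto
    then have "1 + c / M * ((\<Sum>j\<in>T. a i j * ?s j) / real (Suc l)) \<le> 1 + b i / (real n * M) * c"
      by (simp add: mult_ac)
    also have "\<dots> \<le> exp (b i / (real n * M) * c)" by (rule exp_ge_add_one_self)
    finally have "(1 + c / M * ((\<Sum>j\<in>T. a i j * ?s j) / real (Suc l))) * E
        \<le> exp (b i / (real n * M) * c) * E"
      by (intro mult_right_mono) (auto simp: E_def)
    also have "\<dots> = exp (real (Suc l - k) * (b i / (real n * M) * c))"
      using False unfolding E_def exp_add[symmetric] by (simp add: Suc_diff_le distrib_right add_divide_distrib)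
    finally show ?thesis .
  qed
  finally show ?case unfolding c_def .
qed

end

text \<open>\<open>q\<close> is the fraction of rounds left after the sampling phase; \<open>M i\<close> stands for the maximal
  entry of row \<open>i\<close>.\<close>
locale sparse_packing = online_packing +
  fixes M :: "nat \<Rightarrow> real" and d :: nat and B q :: real
  assumes a_le: "\<And>i j. i < m \<Longrightarrow> j < n \<Longrightarrow> a i j \<le> M i"
    and cap: "\<And>i j. i < m \<Longrightarrow> j < n \<Longrightarrow> a i j \<noteq> 0 \<Longrightarrow> B * M i \<le> b i"
    and sparse: "\<And>j. j < n \<Longrightarrow> card {i. i < m \<and> a i j \<noteq> 0} \<le> d"
    and B_ge: "2 \<le> B" and d_pos: "1 \<le> d" and q_pos: "0 < q"
    and ln_q: "ln (2 * exp 1 * q) = - ln (2 * real d) / (B - 1)"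
    and rounds: "real n - 1 - real k \<le> q * real n"
begin

text \<open>The Chernoff parameter: \<open>exp (rate i * M i) = 1 / (2 * q)\<close> makes the moment bound
  at most \<open>exp (b i / (2 * M i))\<close>, and \<open>\<beta> / 2 \<le> \<beta> - 1\<close> for \<open>\<beta> = b i / M i \<ge> B \<ge> 2\<close>.\<close>
definition rate :: "nat \<Rightarrow> real" where
  "rate i = - ln (2 * q) / M i"

lemma M_pos:
  assumes "i < m" "j < n" "a i j \<noteq> 0"
  shows "0 < M i"
  using a_nonneg[OF assms(1,2)] a_le[OF assms(1,2)] assms(3) by linarith

text \<open>\<open>ln_q\<close> encodes \<open>2 * exp 1 * q = (2 * d) powr (-1 / (B - 1))\<close>.
  Splitting off the factor \<open>exp 1\<close> leaves the -1 that later cancels a moment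
  bound.\<close>

lemma ln_2q: "ln (2 * q) = - ln (2 * real d) / (B - 1) - 1"
proof -
  have "ln (2 * exp 1 * q) = ln (exp 1 * (2 * q))" by (simp add: mult_ac)
  also have "\<dots> = 1 + ln (2 * q)" using q_pos by (subst ln_mult) auto
  finally show ?thesis using ln_q by simp
qed

lemma ln_2q_le: "ln (2 * q) \<le> 0"
proof -
  have "0 \<le> ln (2 * real d) / (B - 1)" using d_pos B_ge by simp
  then show ?thesis using ln_2q by simp
qed

lemma rate_nonneg:
  assumes "i < m" "j < n" "a i j \<noteq> 0"
  shows "0 \<le> rate i"
  using M_pos[OF assms] ln_2q_le by (simp add: rate_def divide_le_0_iff)

text \<open>Exponential Markov bound: the weight is at least 1 once the load reaches
  \<open>b i - M i\<close>. The moment is at most \<open>exp (\<beta> - 1)\<close>, which the -1 in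
  \<open>ln_2q\<close> cancels; what remains is at most \<open>1 / (2 * d)\<close> because
  \<open>\<beta> \<ge> B\<close>.\<close>

lemma mean_overload_le:
  assumes "card T = l" "T \<subseteq> {..<n}" "l < n" "i < m" "j < n" "a i j \<noteq> 0"
  shows "mean l T (\<lambda>Y. exp (rate i * (load i Y - (b i - M i)))) \<le> 1 / (2 * real d)"
proof -
  define \<beta> where "\<beta> = b i / M i"
  have M: "0 < M i" using M_pos assms by blast
  have \<beta>: "B \<le> \<beta>" using cap[of i j] assms M by (simp add: \<beta>_def field_simps)
  have rate: "0 \<le> rate i" using rate_nonneg assms by blast
  have expM: "exp (rate i * M i) = 1 / (2 * q)"
    using M q_pos by (simp add: rate_def exp_minus inverse_eq_divide)
  \<comment> \<open>Since \<open>l < n\<close>, at most \<open>n - 1 - k\<close> unsampled rounds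
    precede the current one; the -1 absorbs the rounding of the sampling length.\<close>
  have "real (l - k) \<le> q * real n"
  proof (cases "k \<le> l")
    case True
    then have "real (l - k) \<le> real n - 1 - real k" using assms(3) by (simp add: of_nat_diff)
    with rounds show ?thesis by linarith
  qed (use q_pos in simp)
  then have "real (l - k) / real n \<le> q" using assms(3) by (simp add: divide_simps)
  then have "real (l - k) / real n * (\<beta> / (2 * q)) \<le> q * (\<beta> / (2 * q))"
    using \<beta> B_ge q_pos by (intro mult_right_mono) auto
  also have "\<dots> \<le> \<beta> - 1" using \<beta> B_ge q_pos by simp
  finally have le: "real (l - k) / real n * (\<beta> / (2 * q)) \<le> \<beta> - 1" .
  have "real (l - k) * (b i / (real n * M i) * (exp (rate i * M i) - 1)) =
      real (l - k) / real n * (\<beta> / (2 * q)) - real (l - k) / real n * \<beta>"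
    unfolding expM by (simp add: \<beta>_def algebra_simps)
  also have "\<dots> \<le> \<beta> - 1"
  proof -
    have "0 \<le> real (l - k) / real n * \<beta>" using \<beta> B_ge by (intro mult_nonneg_nonneg) auto
    with le show ?thesis by linarith
  qed
  finally have "mean l T (\<lambda>Y. exp (rate i * load i Y)) \<le> exp (\<beta> - 1)"
    using mean_exp_load_le[OF assms(1,2,4) M a_le[OF assms(4)] rate] by (meson exp_le_cancel_iff order_trans)
  moreover have "mean l T (\<lambda>Y. exp (rate i * (load i Y - (b i - M i)))) =
      exp (- rate i * (b i - M i)) * mean l T (\<lambda>Y. exp (rate i * load i Y))"
    unfolding mean_cmult[symmetric] exp_add[symmetric] by (simp add: algebra_simps)
  moreover have "- rate i * (b i - M i) = ln (2 * q) * (\<beta> - 1)"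
    using M by (simp add: rate_def \<beta>_def field_simps)
  ultimately have "mean l T (\<lambda>Y. exp (rate i * (load i Y - (b i - M i)))) \<le>
      exp (ln (2 * q) * (\<beta> - 1)) * exp (\<beta> - 1)"
    by simp
  also have "\<dots> = exp (- (ln (2 * real d) * ((\<beta> - 1) / (B - 1))))"
    unfolding exp_add[symmetric] ln_2q by (simp add: algebra_simps)
  also have "\<dots> \<le> exp (- ln (2 * real d))"
  proof -
    have "1 \<le> (\<beta> - 1) / (B - 1)" using \<beta> B_ge by simp
    then have "ln (2 * real d) * 1 \<le> ln (2 * real d) * ((\<beta> - 1) / (B - 1))"
      using d_pos by (intro mult_left_mono) auto
    then show ?thesis by simp
  qed
  also have "\<dots> = 1 / (2 * real d)"
    using d_pos by (simp add: exp_minus inverse_eq_divide)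
  finally show ?thesis .
qed

text \<open>Union bound over the at most \<open>d\<close> rows that item \<open>j\<close> uses, each
  overloaded with probability at most \<open>1 / (2 * d)\<close>.\<close>

lemma mean_ok_ge_half:
  assumes "card T = l" "T \<subseteq> {..<n}" "l < n" "j < n" "j \<notin> T"
  shows "1 / 2 \<le> mean l T (\<lambda>Y. if ok (insert j Y) then 1 else 0)"
proof -
  define I where "I = {i. i < m \<and> a i j \<noteq> 0}"
  define h where "h = (\<lambda>i Y. exp (rate i * (load i Y - (b i - M i))))"
  have fin: "finite I" "finite T" using assms finite_subset by (auto simp: I_def)
  have "(\<Sum>i\<in>I. mean l T (h i)) \<le> (\<Sum>i\<in>I. 1 / (2 * real d))"
    unfolding h_def using assms by (intro sum_mono mean_overload_le[where j = j]) (auto simp: I_def)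
  also have "\<dots> \<le> real d * (1 / (2 * real d))"
    using sparse[OF assms(4)] by (simp add: I_def divide_right_mono)
  also have "\<dots> = 1 / 2" using d_pos by simp
  finally have "1 / 2 \<le> 1 + (-1) * (\<Sum>i\<in>I. mean l T (h i))" by simp
  also have "\<dots> = mean l T (\<lambda>Y. 1 + (-1) * (\<Sum>i\<in>I. h i Y))"
    using assms fin by (simp only: mean_add mean_cmult mean_sum mean_const)
  also have "\<dots> \<le> mean l T (\<lambda>Y. if ok (insert j Y) then 1 else 0)"
  proof (rule mean_mono)
    fix Y assume Y: "Y \<subseteq> T" "ok Y"
    have h_nonneg: "0 \<le> h i Y" for i by (simp add: h_def)
    show "1 + (-1) * (\<Sum>i\<in>I. h i Y) \<le> (if ok (insert j Y) then 1 else 0)"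
    proof (cases "ok (insert j Y)")
      case True
      then show ?thesis using h_nonneg by (simp add: sum_nonneg)
    next
      case False
      then obtain i where i: "i < m" "b i < load i (insert j Y)"
        by (auto simp: ok_iff not_le)
      have load: "load i (insert j Y) = load i Y + a i j"
        using Y assms by (intro load_insert) auto
      \<comment> \<open>\<open>Y\<close> itself is feasible, so only a row used by \<open>j\<close>
        can become violated.\<close>
      have "a i j \<noteq> 0"
        using i load Y(2) by (auto simp: ok_iff not_le)
      then have "i \<in> I" "0 \<le> rate i"
        using i rate_nonneg[of i j] assms by (auto simp: I_def)
      moreover have "0 \<le> load i Y - (b i - M i)"
        using i load a_le[of i j] assms by auto
      ultimately have "1 \<le> h i Y" by (simp add: h_def)
      also have "\<dots> \<le> (\<Sum>i\<in>I. h i Y)"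
        using \<open>i \<in> I\<close> h_nonneg fin by (intro member_le_sum) auto
      finally show ?thesis using False by simp
    qed
  qed (use assms in auto)
  finally show ?thesis .
qed

end

section \<open>The value of the output\<close>

text \<open>\<open>z\<close> is a fixed benchmark point; the supremum over feasible \<open>z\<close>
  is taken only at the very end.\<close>

locale submodular_packing = sparse_packing +
  fixes f :: "nat set \<Rightarrow> real" and \<alpha> :: real and z :: "nat \<Rightarrow> real"
  assumes f_nonneg: "\<And>S. S \<subseteq> {..<n} \<Longrightarrow> 0 \<le> f S"
    and mono: "monotone_set_fun {..<n} f" and submod: "submodular_set_fun {..<n} f"
    and \<alpha>_nonneg: "0 \<le> \<alpha>" and z: "\<And>j. j < n \<Longrightarrow> 0 \<le> z j \<and> z j \<le> 1"
    and orc_value: "\<And>l S. 1 \<le> l \<Longrightarrow> l \<le> n \<Longrightarrow> S \<subseteq> {..<n} \<Longrightarrow>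
      \<alpha> * (real l / real n) * mext {..<n} z (\<lambda>R. f (R \<inter> S)) \<le> mext {..<n} (orc l S) f"
begin

definition phi :: "nat set \<Rightarrow> real" where
  "phi T = mext {..<n} z (\<lambda>R. f (R \<inter> T))"

text \<open>Closed-form subsolution of the backward recursion: it bounds from below the expected
  value after rounds \<open>k + 1\<close> to \<open>l\<close> add their tentative selections to
  \<open>W\<close>. For \<open>k > 0\<close> it starts at \<open>f W\<close> when
  \<open>l = k\<close>.\<close>

definition lb :: "nat \<Rightarrow> nat set \<Rightarrow> nat set \<Rightarrow> real" where
  "lb l T W = \<alpha> * real k * (real l - real k) / (real l * real n) * phi T + real k / real l * f W"

lemma monoD: "S \<subseteq> T \<Longrightarrow> T \<subseteq> {..<n} \<Longrightarrow> f S \<le> f T"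
  using mono by (auto simp: monotone_set_fun_def)

lemma phi_nonneg: "0 \<le> phi T"
proof -
  have "mext {..<n} z (\<lambda>_. 0) \<le> phi T"
    unfolding phi_def using z by (intro mext_mono f_nonneg) auto
  then show ?thesis by simp
qed

lemma sum_sel_marginal_ge:
  assumes "k < l" "l \<le> n" "T \<subseteq> {..<n}" "W \<subseteq> {..<n}"
  shows "\<alpha> * (real l / real n) * phi T - f W \<le> (\<Sum>j\<in>T. sel l T j * (f (insert j W) - f W))"
proof -
  have x: "orc l T \<in> polytope m n a b (real l / real n) T"
    using assms by (intro orc_polytope) auto
  have "\<alpha> * (real l / real n) * phi T \<le> mext {..<n} (orc l T) f"
    unfolding phi_def using assms by (intro orc_value) auto
  also have "\<dots> \<le> f W + (\<Sum>j<n. orc l T j * (f (insert j W) - f W))"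
    using submod mono assms x by (intro mext_le_sum_marginals) (auto simp: polytope_def)
  also have "(\<Sum>j<n. orc l T j * (f (insert j W) - f W)) =
      (\<Sum>j\<in>T. sel l T j * (f (insert j W) - f W))"
    using assms x by (intro sum.mono_neutral_cong_right) (auto simp: polytope_def sel_def)
  finally show ?thesis by simp
qed

text \<open>One step of the recursion: random deletion controls the loss in \<open>phi\<close>, and
  \<open>sum_sel_marginal_ge\<close> supplies the gain in \<open>f W\<close>.\<close>

lemma sum_lb_ge:
  assumes "card T = Suc l" "T \<subseteq> {..<n}" "k \<le> l" "W \<subseteq> {..<n}"
  shows "real (Suc l) * lb (Suc l) T W \<le> (\<Sum>j\<in>T. sel (Suc l) T j * lb l (T - {j}) (insert j W)
    + (1 - sel (Suc l) T j) * lb l (T - {j}) W)"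
proof (cases "l = 0")
  case True
  \<comment> \<open>Here \<open>k = 0\<close>, and every coefficient of \<open>lb\<close>
    vanishes.\<close>
  with assms(3) show ?thesis unfolding lb_def by simp
next
  case False
  let ?s = "sel (Suc l) T"
  have n: "Suc l \<le> n" using card_le_n[OF assms(2)] assms(1) by simp
  define A where "A = \<alpha> * real k * (real l - real k) / (real l * real n)"
  have A: "0 \<le> A" using \<alpha>_nonneg assms(3) by (simp add: A_def)
  have phi: "real l * phi T \<le> (\<Sum>j\<in>T. phi (T - {j}))"
    using mext_delete_ge[OF submod mono _ assms(2) _ z] f_nonneg[of "{}"] assms(1)
    by (simp add: phi_def)
  have "real (Suc l) * lb (Suc l) T W = \<alpha> * real k * (real l - real k + 1) / real n * phi T + real k * f W"
  proof -
    have "x * (\<alpha> * real k * (x - real k) / (x * real n) * p + real k / x * w) =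
        \<alpha> * real k * (x - real k) / real n * p + real k * w" if "x \<noteq> 0" for x p w :: real
      using that by (cases "real n = 0") (simp_all add: field_simps)
    moreover have "real (Suc l) - real k = real l - real k + 1" by simp
    ultimately show ?thesis unfolding lb_def by (metis of_nat_neq_0)
  qed
  also have "\<dots> = A * (real l * phi T) + real k * f W + real k * \<alpha> / real n * phi T"
  proof -
    have "A * (real l * phi T) = \<alpha> * real k * (real l - real k) / real n * phi T"
      using False by (simp add: A_def)
    then show ?thesis by (simp add: algebra_simps add_divide_distrib diff_divide_distrib)
  qed
  \<comment> \<open>The harmless factor \<open>(l + 1) / l \<ge> 1\<close> brings the term into the
    shape of the oracle bound.\<close>
  also have "\<dots> \<le> A * (real l * phi T) + real k * f W
      + (real k / real l) * (\<alpha> * (real (Suc l) / real n) * phi T)"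
  proof -
    have "real k * \<alpha> / real n * phi T * 1 \<le> real k * \<alpha> / real n * phi T * (real (Suc l) / real l)"
      using False \<alpha>_nonneg phi_nonneg[of T] by (intro mult_left_mono) auto
    then show ?thesis by (simp add: mult_ac)
  qed
  also have "\<dots> = A * (real l * phi T) + (real k / real l) *
      (real (Suc l) * f W + (\<alpha> * (real (Suc l) / real n) * phi T - f W))"
  proof -
    have "c + real k * w + real k / real l * x = c + real k / real l * (real (Suc l) * w + (x - w))"
      for c w x :: real
      using False by (simp add: field_simps)
    then show ?thesis .
  qed
  also have "\<dots> \<le> A * (\<Sum>j\<in>T. phi (T - {j})) + (real k / real l) *
      (real (Suc l) * f W + (\<Sum>j\<in>T. ?s j * (f (insert j W) - f W)))"
    using A phi sum_sel_marginal_ge[of "Suc l" T W] assms n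
    by (intro add_mono mult_left_mono) auto
  also have "\<dots> = (\<Sum>j\<in>T. A * phi (T - {j}) + real k / real l * (f W + ?s j * (f (insert j W) - f W)))"
    by (simp only: sum.distrib sum_distrib_left[symmetric] sum_constant assms(1))
  also have "\<dots> = (\<Sum>j\<in>T. ?s j * lb l (T - {j}) (insert j W) + (1 - ?s j) * lb l (T - {j}) W)"
    unfolding lb_def A_def[symmetric] by (intro sum.cong) (simp_all add: algebra_simps)
  finally show ?thesis .
qed

text \<open>The map \<open>w\<close> sends the set accepted in the first \<open>l\<close> rounds to the set accepted afterwards,
  and \<open>W\<close> is the set of items tentatively selected afterwards. Adding the accepted items from
  the last one to the first one, the marginal gain of the item of round \<open>l\<close> is measured against
  a subset of \<open>W\<close>, hence is bounded below by a quantity that does not depend on the earlier rounds,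
  whereas its feasibility depends on the earlier rounds only.\<close>
lemma mean_union_ge:
  assumes "k \<le> l" "card T = l" "T \<subseteq> {..<n}" "W \<subseteq> {..<n}" "\<And>Y. w Y \<subseteq> W"
  shows "mean l T (\<lambda>Y. f (w Y)) + (lb l T W - f W) / 2 \<le> mean l T (\<lambda>Y. f (Y \<union> w Y))"
  using assms
proof (induction l arbitrary: T W w rule: dec_induct)
  case base
  \<comment> \<open>\<open>lb k T W\<close> is \<open>f W\<close> for \<open>k > 0\<close>, and 0
    for \<open>k = 0\<close> since division by zero yields 0.\<close>
  have lb: "(lb k T W - f W) / 2 \<le> 0" unfolding lb_def using f_nonneg[of W] base by (cases "k = 0") auto
  have "mean k T (\<lambda>Y. f (w Y)) \<le> mean k T (\<lambda>Y. f (Y \<union> w Y))"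
  proof (rule mean_mono)
    fix Y assume "Y \<subseteq> T"
    then show "f (w Y) \<le> f (Y \<union> w Y)" using base.prems(2,3) base.prems(4)[of Y] by (intro monoD) auto
  qed (use base in auto)
  from add_mono[OF this lb] show ?case by simp
next
  case (step l)
  let ?s = "sel (Suc l) T"
  have n: "Suc l \<le> n" using card_le_n[OF step.prems(2)] step.prems(1) by simp
  have fin: "finite T" using finite_subset[OF step.prems(2)] by simp
  define G where "G = (\<lambda>j. mean l (T - {j}) (\<lambda>Y. ?s j * f (place j Y \<union> w (place j Y)) + (1 - ?s j) * f (Y \<union> w Y)))"
  define H where "H = (\<lambda>j. mean l (T - {j}) (\<lambda>Y. ?s j * f (w (place j Y)) + (1 - ?s j) * f (w Y)))"
  have GH: "H j + (?s j * lb l (T - {j}) (insert j W) + (1 - ?s j) * lb l (T - {j}) W - f W) / 2 \<le> G j"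
    if j: "j \<in> T" for j
  proof -
    have jn: "j < n" using j step.prems by auto
    have s: "0 \<le> ?s j" "?s j \<le> 1" using sel_bounds[of "Suc l" T j] n step.prems jn by auto
    have T: "card (T - {j}) = l" "T - {j} \<subseteq> {..<n}"
      using step.prems j fin by (auto simp: card_Diff_singleton)
    \<comment> \<open>If \<open>j\<close> fits, it is moved into the later accepted set, so that
      \<open>Y \<union> w' Y\<close> is the full output; the induction hypothesis then applies with
      \<open>insert j W\<close>.\<close>
    define w' where "w' = (\<lambda>Y. if ok (insert j Y) then insert j (w (insert j Y)) else w Y)"
    define g where "g = f (insert j W) - f W"
    have g: "0 \<le> g" unfolding g_def using monoD[of W "insert j W"] step.prems(3) jn by auto
    \<comment> \<open>Half of the gain \<open>g\<close> survives because \<open>j\<close> fits with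
      probability at least 1/2, and \<open>g\<close> does not depend on \<open>Y\<close>.\<close>
    have "mean l (T - {j}) (\<lambda>Y. f (w (place j Y))) + g / 2 \<le>
        mean l (T - {j}) (\<lambda>Y. f (w (place j Y))) + g * mean l (T - {j}) (\<lambda>Y. if ok (insert j Y) then 1 else 0)"
      using mult_left_mono[OF mean_ok_ge_half[OF T _ jn] g] n by auto
    also have "\<dots> = mean l (T - {j}) (\<lambda>Y. f (w (place j Y)) + g * (if ok (insert j Y) then 1 else 0))"
      by (simp only: mean_add mean_cmult)
    also have "\<dots> \<le> mean l (T - {j}) (\<lambda>Y. f (w' Y))"
    proof (rule mean_mono)
      fix Y
      have "g \<le> f (insert j (w (insert j Y))) - f (w (insert j Y))"
        unfolding g_def using step.prems(3) step.prems(4)[of "insert j Y"] jn mono submod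
        by (intro marginal_antimono) auto
      then show "f (w (place j Y)) + g * (if ok (insert j Y) then 1 else 0) \<le> f (w' Y)"
        by (simp add: w'_def place_def)
    qed (use T in auto)
    finally have 1: "mean l (T - {j}) (\<lambda>Y. f (w (place j Y))) + g / 2 \<le> mean l (T - {j}) (\<lambda>Y. f (w' Y))" .
    have "w' Y \<subseteq> insert j W" for Y
      using step.prems(4)[of Y] step.prems(4)[of "insert j Y"] by (auto simp: w'_def)
    then have "mean l (T - {j}) (\<lambda>Y. f (w' Y)) + (lb l (T - {j}) (insert j W) - f (insert j W)) / 2
        \<le> mean l (T - {j}) (\<lambda>Y. f (Y \<union> w' Y))"
      using T step.prems(3) jn by (intro step.IH) auto
    also have "(\<lambda>Y. f (Y \<union> w' Y)) = (\<lambda>Y. f (place j Y \<union> w (place j Y)))"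
      by (auto simp: w'_def place_def)
    finally have 2: "mean l (T - {j}) (\<lambda>Y. f (w (place j Y))) + (lb l (T - {j}) (insert j W) - f W) / 2
        \<le> mean l (T - {j}) (\<lambda>Y. f (place j Y \<union> w (place j Y)))"
      using 1 unfolding g_def by argo
    have 3: "mean l (T - {j}) (\<lambda>Y. f (w Y)) + (lb l (T - {j}) W - f W) / 2
        \<le> mean l (T - {j}) (\<lambda>Y. f (Y \<union> w Y))"
      using T step.prems by (intro step.IH) auto
    \<comment> \<open>Split on the coin of \<open>j\<close>: once selected, \<open>j\<close> joins
      \<open>W\<close> whether or not it fits.\<close>
    have "H j + (?s j * lb l (T - {j}) (insert j W) + (1 - ?s j) * lb l (T - {j}) W - f W) / 2 =
      ?s j * (mean l (T - {j}) (\<lambda>Y. f (w (place j Y))) + (lb l (T - {j}) (insert j W) - f W) / 2) +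
      (1 - ?s j) * (mean l (T - {j}) (\<lambda>Y. f (w Y)) + (lb l (T - {j}) W - f W) / 2)"
      unfolding H_def mean_add mean_cmult by (simp add: field_simps)
    also have "\<dots> \<le> G j"
      unfolding G_def mean_add mean_cmult using s 2 3 by (intro add_mono mult_left_mono) auto
    finally show ?thesis .
  qed
  have "real (Suc l) * lb (Suc l) T W \<le> (\<Sum>j\<in>T. ?s j * lb l (T - {j}) (insert j W)
    + (1 - ?s j) * lb l (T - {j}) W)"
    using step by (intro sum_lb_ge) auto
  then have "(\<Sum>j\<in>T. H j) + (real (Suc l) * lb (Suc l) T W - real (Suc l) * f W) / 2 \<le>
    (\<Sum>j\<in>T. H j) + ((\<Sum>j\<in>T. ?s j * lb l (T - {j}) (insert j W)
    + (1 - ?s j) * lb l (T - {j}) W) - real (Suc l) * f W) / 2"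
    by simp
  also have "\<dots> = (\<Sum>j\<in>T. H j + (?s j * lb l (T - {j}) (insert j W)
    + (1 - ?s j) * lb l (T - {j}) W - f W) / 2)"
    using step.prems(1) by (simp add: sum.distrib sum_subtractf flip: sum_divide_distrib)
  also have "\<dots> \<le> (\<Sum>j\<in>T. G j)" by (intro sum_mono GH)
  finally have "((\<Sum>j\<in>T. H j) + (real (Suc l) * lb (Suc l) T W - real (Suc l) * f W) / 2) / real (Suc l)
    \<le> (\<Sum>j\<in>T. G j) / real (Suc l)" by (intro divide_right_mono) auto
  moreover have "((\<Sum>j\<in>T. H j) + (real (Suc l) * lb (Suc l) T W - real (Suc l) * f W) / 2) / real (Suc l)
    = (\<Sum>j\<in>T. H j) / real (Suc l) + (lb (Suc l) T W - f W) / 2"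
    by (simp add: field_simps del: of_nat_Suc)
  ultimately show ?case by (simp add: G_def H_def)
qed

lemma mean_value_ge:
  assumes "k \<le> n"
  shows "\<alpha> / 2 * (real k / real n) * (1 - real k / real n) * mext {..<n} z f \<le> mean n {..<n} f"
proof -
  have "mean n {..<n} (\<lambda>_. f {}) + (lb n {..<n} {} - f {}) / 2 \<le> mean n {..<n} (\<lambda>Y. f (Y \<union> {}))"
    using assms by (intro mean_union_ge) auto
  then have "f {} / 2 + lb n {..<n} {} / 2 \<le> mean n {..<n} f"
    by (simp add: mean_const) argo
  moreover have "0 \<le> f {}" "0 \<le> real k / real n * f {}" using f_nonneg[of "{}"] by auto
  moreover have "phi {..<n} = mext {..<n} z f"
    unfolding phi_def by (intro mext_cong) (simp add: Int_absorb2)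
  then have "lb n {..<n} {} = 2 * (\<alpha> / 2 * (real k / real n) * (1 - real k / real n) * mext {..<n} z f)
      + real k / real n * f {}"
    unfolding lb_def by (cases "n = 0") (simp_all add: field_simps)
  ultimately show ?thesis by linarith
qed

end

section \<open>The competitive ratio\<close>

lemma bdd_above_multilinear_ext:
  assumes "monotone_set_fun {..<n} f"
  shows "bdd_above (multilinear_ext n f ` polytope m n a b t S)"
proof (rule bdd_aboveI2)
  fix x assume "x \<in> polytope m n a b t S"
  then have "mext {..<n} x f \<le> mext {..<n} x (\<lambda>_. f {..<n})"
    using assms by (intro mext_mono) (auto simp: polytope_def monotone_set_fun_def)
  then show "multilinear_ext n f x \<le> f {..<n}"
    by (simp add: multilinear_ext_eq_mext)
qed

lemma scaled_restriction_in_polytope: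
  assumes "\<And>i j. i < m \<Longrightarrow> j < n \<Longrightarrow> 0 \<le> a i j" "z \<in> polytope m n a b 1 {..<n}" "0 \<le> t" "t \<le> 1"
  shows "(\<lambda>j. (if j \<in> S then z j else 0) * t) \<in> polytope m n a b t S"
proof -
  have "(\<Sum>j<n. a i j * ((if j \<in> S then z j else 0) * t)) \<le> t * b i" if i: "i < m" for i
  proof -
    have "(\<Sum>j<n. a i j * ((if j \<in> S then z j else 0) * t)) \<le> (\<Sum>j<n. t * (a i j * z j))"
      using assms i by (intro sum_mono) (auto simp: polytope_def mult_ac)
    also have "\<dots> = t * (\<Sum>j<n. a i j * z j)" by (simp add: sum_distrib_left)
    also have "\<dots> \<le> t * b i" using assms i by (intro mult_left_mono) (auto simp: polytope_def)
    finally show ?thesis .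
  qed
  then show ?thesis using assms(2-4) by (auto simp: polytope_def intro: mult_le_one)
qed

text \<open>The competitor in the oracle's polytope is \<open>z\<close> restricted to
  \<open>S\<close> and scaled by \<open>l / n\<close>; scaling costs at most the factor
  \<open>l / n\<close>.\<close>

lemma oracle_value_ge:
  assumes a: "\<And>i j. i < m \<Longrightarrow> j < n \<Longrightarrow> 0 \<le> a i j"
    and f: "monotone_set_fun {..<n} f" "submodular_set_fun {..<n} f" "0 \<le> f {}"
    and orc: "approx_oracle m n a b f \<alpha> orc" and \<alpha>: "0 \<le> \<alpha>"
    and z: "z \<in> polytope m n a b 1 {..<n}" and l: "1 \<le> l" "l \<le> n" "S \<subseteq> {..<n}"
  shows "\<alpha> * (real l / real n) * mext {..<n} z (\<lambda>R. f (R \<inter> S)) \<le> mext {..<n} (orc l S) f"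
proof -
  define t where "t = real l / real n"
  define y where "y = (\<lambda>j. (if j \<in> S then z j else 0) * t)"
  have t: "0 \<le> t" "t \<le> 1" using l by (auto simp: t_def)
  have y: "y \<in> polytope m n a b t S"
    unfolding y_def using a z t by (rule scaled_restriction_in_polytope)
  have "t * mext {..<n} z (\<lambda>R. f (R \<inter> S)) = t * mext {..<n} (\<lambda>j. if j \<in> S then z j else 0) f"
    by (simp add: mext_restrict)
  also have "\<dots> \<le> mext {..<n} y f"
    unfolding y_def using f z t by (intro mext_scale_ge) (auto simp: polytope_def)
  also have "\<dots> \<le> Sup (multilinear_ext n f ` polytope m n a b t S)"
    unfolding multilinear_ext_eq_mext[symmetric]
    using y f by (intro cSup_upper bdd_above_multilinear_ext) auto
  finally have "\<alpha> * (t * mext {..<n} z (\<lambda>R. f (R \<inter> S))) \<le>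
      \<alpha> * Sup (multilinear_ext n f ` polytope m n a b t S)"
    using \<alpha> by (rule mult_left_mono)
  also have "\<dots> \<le> multilinear_ext n f (orc l S)"
    using orc l by (auto simp: approx_oracle_def t_def)
  finally show ?thesis by (simp add: multilinear_ext_eq_mext t_def mult.assoc)
qed

section \<open>Instance parameters and the sampling fraction\<close>

lemma cap_ratio_mult_le:
  assumes "\<And>j. j < n \<Longrightarrow> 0 \<le> a i j" "i < m" "j < n" "a i j \<noteq> 0"
  shows "cap_ratio m n a b * Max ((\<lambda>j. a i j) ` {..<n}) \<le> b i"
proof -
  have "0 < a i j" using assms(1)[OF assms(3)] assms(4) by simp
  also have "a i j \<le> Max ((\<lambda>j. a i j) ` {..<n})" using assms by (intro Max_ge) auto
  finally have "0 < Max ((\<lambda>j. a i j) ` {..<n})" .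
  moreover have "cap_ratio m n a b \<le> b i / Max ((\<lambda>j. a i j) ` {..<n})"
    unfolding cap_ratio_def using assms by (intro Min_le) auto
  ultimately show ?thesis by (simp add: pos_le_divide_eq)
qed

lemma card_col_le_col_sparsity:
  assumes "j < n"
  shows "card {i. i < m \<and> a i j \<noteq> 0} \<le> col_sparsity m n a"
  unfolding col_sparsity_def using assms by (intro Max_ge) auto

lemma col_sparsity_pos:
  assumes "i < m" "j < n" "a i j \<noteq> 0"
  shows "1 \<le> col_sparsity m n a"
proof -
  have "{i. i < m \<and> a i j \<noteq> 0} \<noteq> {}" using assms by auto
  then have "1 \<le> card {i. i < m \<and> a i j \<noteq> 0}" by (simp add: Suc_le_eq card_gt_0_iff)
  with card_col_le_col_sparsity[OF assms(2), of m a] show ?thesis by linarith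
qed

lemma sample_frac_bounds:
  assumes "1 \<le> d" "2 \<le> B"
  defines "q \<equiv> 1 - sample_frac d B"
  shows "0 < q" "q \<le> 1 / 4" "ln (2 * exp 1 * q) = - ln (2 * real d) / (B - 1)"
    "real d powr (- 1 / (B - 1)) / (4 * exp 1) \<le> q"
proof -
  define t where "t = 1 / (B - 1)"
  have t: "0 \<le> t" "t \<le> 1" using assms by (auto simp: t_def)
  have q: "q = (1 / (2 * real d)) powr t / (2 * exp 1)"
    by (simp add: q_def sample_frac_def t_def)
  show "0 < q" unfolding q using assms(1) by simp
  have e: "2 \<le> exp (1::real)" using exp_ge_add_one_self[of 1] by simp
  have "(1 / (2 * real d)) powr t \<le> 1" using assms t by (intro powr_le1) auto
  moreover have "4 \<le> 2 * exp (1::real)" using e by simp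
  ultimately show "q \<le> 1 / 4" unfolding q by (intro frac_le) auto
  have "2 * exp 1 * q = (1 / (2 * real d)) powr t" by (simp add: q)
  then show "ln (2 * exp 1 * q) = - ln (2 * real d) / (B - 1)"
    using assms(1) by (simp add: ln_powr ln_div t_def)
  \<comment> \<open>As \<open>B \<ge> 2\<close>, the exponent \<open>t\<close> is at most 1, so the
    factor 2 inside the power costs at most a factor 2.\<close>
  have "1 / 2 * real d powr (- t) \<le> (1 / 2) powr t * real d powr (- t)"
    using powr_mono'[of t 1 "1 / 2"] t by (intro mult_right_mono) auto
  also have "\<dots> = (1 / (2 * real d)) powr t"
    using assms(1) by (simp add: powr_divide powr_mult powr_minus field_simps)
  finally have "1 / 2 * real d powr (- t) / (2 * exp 1) \<le> q"
    unfolding q by (intro divide_right_mono) auto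
  then show "real d powr (- 1 / (B - 1)) / (4 * exp 1) \<le> q"
    by (simp add: t_def)
qed

theorem mainTheorem15:
  "\<exists>c0::real. c0 > 0 \<and>
     (\<forall>(d::nat) (B::real). \<exists>g::nat \<Rightarrow> real. g \<longlonglongrightarrow> 0 \<and>
       (\<forall>(n::nat) (m::nat) (a::nat \<Rightarrow> nat \<Rightarrow> real) (b::nat \<Rightarrow> real) (f::nat set \<Rightarrow> real)
          (\<alpha>::real) (orc::nat \<Rightarrow> nat set \<Rightarrow> nat \<Rightarrow> real).
          (\<forall>i<m. \<forall>j<n. 0 \<le> a i j \<and> a i j \<le> 1) \<and>
          (\<forall>i<m. b i > 0) \<and>
          (\<exists>i<m. \<exists>j<n. a i j \<noteq> 0) \<and>
          (\<forall>S\<subseteq>{..<n}. f S \<ge> 0) \<and>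
          monotone_set_fun {..<n} f \<and> submodular_set_fun {..<n} f \<and>
          0 < \<alpha> \<and> \<alpha> \<le> 1 \<and>
          approx_oracle m n a b f \<alpha> orc \<and>
          B = cap_ratio m n a b \<and> B \<ge> 2 \<and>
          d = col_sparsity m n a
          \<longrightarrow>
          (\<forall>Y \<in> set_pmf (alg_output m n a b orc (sample_frac d B)).
              packing_ok m n a b (ind_vec Y)) \<and>
          measure_pmf.expectation (alg_output m n a b orc (sample_frac d B))
              (\<lambda>Y. multilinear_ext n f (ind_vec Y))
            \<ge> (c0 * \<alpha> * real d powr (- 1 / (B - 1)) - g n) * F_star m n a b f))"
proof (intro exI[of _ "1 / (16 * exp 1)"] conjI allI exI[of _ "\<lambda>n. 1 / real n"] impI)
  \<comment> \<open>The constant combines 1/2 for fitting, 1/2 from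
    \<open>q * (1 - q) \<ge> q / 2\<close>, and \<open>1 / (4 * exp 1)\<close> from the lower bound
    on \<open>q\<close>. The error \<open>1 / n\<close> pays for rounding the sampling
    length.\<close>
  show "(0::real) < 1 / (16 * exp 1)" by simp
  show "(\<lambda>n. 1 / real n) \<longlonglongrightarrow> 0" by (rule lim_1_over_n)
next
  fix d B n m and a :: "nat \<Rightarrow> nat \<Rightarrow> real" and b :: "nat \<Rightarrow> real" and f :: "nat set \<Rightarrow> real"
    and \<alpha> :: real and orc :: "nat \<Rightarrow> nat set \<Rightarrow> nat \<Rightarrow> real"
  assume "(\<forall>i<m. \<forall>j<n. 0 \<le> a i j \<and> a i j \<le> 1) \<and> (\<forall>i<m. b i > 0) \<and>
      (\<exists>i<m. \<exists>j<n. a i j \<noteq> 0) \<and> (\<forall>S\<subseteq>{..<n}. f S \<ge> 0) \<and>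
      monotone_set_fun {..<n} f \<and> submodular_set_fun {..<n} f \<and>
      0 < \<alpha> \<and> \<alpha> \<le> 1 \<and> approx_oracle m n a b f \<alpha> orc \<and>
      B = cap_ratio m n a b \<and> B \<ge> 2 \<and> d = col_sparsity m n a"
  then have a: "\<And>i j. i < m \<Longrightarrow> j < n \<Longrightarrow> 0 \<le> a i j" and b: "\<And>i. i < m \<Longrightarrow> 0 < b i"
    and nz: "\<exists>i<m. \<exists>j<n. a i j \<noteq> 0" and f_nonneg: "\<And>S. S \<subseteq> {..<n} \<Longrightarrow> 0 \<le> f S"
    and mono: "monotone_set_fun {..<n} f" and submod: "submodular_set_fun {..<n} f"
    and \<alpha>: "0 < \<alpha>" "\<alpha> \<le> 1" and orc: "approx_oracle m n a b f \<alpha> orc"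
    and B: "B = cap_ratio m n a b" "2 \<le> B" and d: "d = col_sparsity m n a"
    by blast+
  let ?p = "sample_frac d B"
  define q where "q = 1 - ?p"
  define k where "k = nat \<lfloor>?p * real n\<rfloor>"
  have n: "0 < n" using nz by auto
  have d1: "1 \<le> d" using nz col_sparsity_pos unfolding d by blast
  note q = sample_frac_bounds[OF d1 B(2), folded q_def]
  have p: "?p = 1 - q" by (simp add: q_def)
  have pn: "0 \<le> ?p * real n" using q by (simp add: p)
  have k: "real l \<le> ?p * real n \<longleftrightarrow> l \<le> k" for l
    using pn by (simp add: k_def le_nat_iff le_floor_iff)
  have k_le: "real k \<le> ?p * real n" using k by blast
  have k_ge: "?p * real n \<le> real k + 1" using k[of "Suc k"] by simp
  have "real k \<le> 1 * real n" using k_le q(1) mult_right_mono[of ?p 1 "real n"] by (simp add: p)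
  then have k_n: "k \<le> n" by simp
  interpret online_packing n m k a b orc
    using a b orc by unfold_locales (auto simp: approx_oracle_def)
  interpret sparse_packing n m k a b orc "\<lambda>i. Max ((\<lambda>j. a i j) ` {..<n})" d B q
  proof unfold_locales
    show "a i j \<le> Max (a i ` {..<n})" if "i < m" "j < n" for i j
      using that by (intro Max_ge) auto
    show "B * Max (a i ` {..<n}) \<le> b i" if "i < m" "j < n" "a i j \<noteq> 0" for i j
      using that a unfolding B(1) by (intro cap_ratio_mult_le) auto
    show "card {i. i < m \<and> a i j \<noteq> 0} \<le> d" if "j < n" for j
      using that unfolding d by (rule card_col_le_col_sparsity)
    show "real n - 1 - real k \<le> q * real n"
      using k_ge by (simp add: p algebra_simps)
  qed (use q d1 B in auto)

  let ?E = "measure_pmf.expectation (alg_output m n a b orc ?p) (\<lambda>Y. multilinear_ext n f (ind_vec Y))"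
  define r where "r = real k / real n"
  define \<kappa> where "\<kappa> = \<alpha> / 2 * r * (1 - r)"
  have "1 - q \<le> (real k + 1) / real n"
    using k_ge n by (simp add: p pos_le_divide_eq)
  moreover have "r \<le> 1 - q"
    using k_le n by (simp add: r_def p pos_divide_le_eq)
  ultimately have r: "0 \<le> r" "1 - q - 1 / real n \<le> r" "q \<le> 1 - r"
    by (simp_all add: r_def add_divide_distrib)
  have \<kappa>: "0 \<le> \<kappa>" using \<alpha> r q(1) by (simp add: \<kappa>_def)
  have E: "?E = mean n {..<n} f"
  proof -
    have "multilinear_ext n f (ind_vec Y) = f Y" if "Y \<subseteq> {..<n}" for Y
      using that by (simp add: multilinear_ext_eq_mext ind_vec_def mext_indicator Int_absorb1)
    then have "mean n {..<n} (\<lambda>Y. multilinear_ext n f (ind_vec Y)) = mean n {..<n} f"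
      by (intro mean_cong) auto
    then show ?thesis
      unfolding alg_output_eq_rev_run by (subst expectation_rev_run) (auto simp: k)
  qed
  have value_ge: "\<kappa> * multilinear_ext n f z \<le> ?E" if z: "z \<in> polytope m n a b 1 {..<n}" for z
  proof -
    \<comment> \<open>Interpreted separately for each feasible \<open>z\<close>, as the supremum
      need not be known to be attained.\<close>
    interpret submodular_packing n m k a b orc "\<lambda>i. Max ((\<lambda>j. a i j) ` {..<n})" d B q f \<alpha> z
    proof unfold_locales
      show "\<alpha> * (real l / real n) * mext {..<n} z (\<lambda>R. f (R \<inter> S)) \<le> mext {..<n} (orc l S) f"
        if "1 \<le> l" "l \<le> n" "S \<subseteq> {..<n}" for l S
        using a mono submod f_nonneg[of "{}"] orc \<alpha>(1) z that by (intro oracle_value_ge) auto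
    qed (use f_nonneg mono submod \<alpha> z in \<open>auto simp: polytope_def\<close>)
    show ?thesis
      using mean_value_ge[OF k_n] unfolding E multilinear_ext_eq_mext[of n f z] \<kappa>_def r_def .
  qed
  have zero: "(\<lambda>_. 0) \<in> polytope m n a b 1 {..<n}"
    using b by (auto simp: polytope_def less_imp_le)
  have zero_value: "multilinear_ext n f (\<lambda>_. 0) = f {}"
    using mext_indicator[of "{..<n}" "{}" f] by (simp add: multilinear_ext_eq_mext)
  have F_nonneg: "0 \<le> F_star m n a b f"
  proof -
    have "multilinear_ext n f (\<lambda>_. 0) \<le> F_star m n a b f"
      unfolding F_star_def using zero mono by (intro cSup_upper bdd_above_multilinear_ext) auto
    with zero_value f_nonneg[of "{}"] show ?thesis by simp
  qed
  have "\<kappa> * F_star m n a b f \<le> ?E"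
  \<comment> \<open>Passing to the supremum divides by \<open>\<kappa>\<close>; for
    \<open>\<kappa> = 0\<close> the bound at the zero vector gives nonnegativity of the
    expectation.\<close>
  proof (cases "\<kappa> = 0")
    case True
    then show ?thesis using value_ge[OF zero] by simp
  next
    case False
    with \<kappa> have "0 < \<kappa>" by simp
    then have "F_star m n a b f \<le> ?E / \<kappa>"
      unfolding F_star_def using zero value_ge
      by (intro cSup_least) (auto simp: pos_le_divide_eq mult.commute)
    with \<open>0 < \<kappa>\<close> show ?thesis by (simp add: pos_le_divide_eq mult.commute)
  qed
  moreover have "1 / (16 * exp 1) * \<alpha> * real d powr (- 1 / (B - 1)) - 1 / real n \<le> \<kappa>"
  proof -
    have "q / 2 - 1 / real n \<le> (1 - q - 1 / real n) * q"
    proof -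
      have "q * q \<le> 1 / 2 * q" "q * (1 / real n) \<le> 1 * (1 / real n)"
        using q(1,2) by (intro mult_right_mono; simp)+
      then show ?thesis by (simp add: algebra_simps)
    qed
    also have "\<dots> \<le> r * q" using r q(1) by (intro mult_right_mono) auto
    also have "\<dots> \<le> r * (1 - r)" using r by (intro mult_left_mono) auto
    finally have "\<alpha> / 2 * (q / 2 - 1 / real n) \<le> \<alpha> / 2 * (r * (1 - r))"
      using \<alpha> by (intro mult_left_mono) auto
    moreover have "\<alpha> / 4 * (real d powr (- 1 / (B - 1)) / (4 * exp 1)) \<le> \<alpha> / 4 * q"
      using q(4) \<alpha> by (intro mult_left_mono) auto
    moreover have "\<alpha> / 2 * (1 / real n) \<le> 1 * (1 / real n)"
      using \<alpha> by (intro mult_right_mono) auto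
    ultimately show ?thesis by (simp add: \<kappa>_def algebra_simps)
  qed
  ultimately show "(1 / (16 * exp 1) * \<alpha> * real d powr (- 1 / (B - 1)) - 1 / real n)
      * F_star m n a b f \<le> ?E"
    using F_nonneg by (meson mult_right_mono order_trans)
  show "\<forall>Y \<in> set_pmf (alg_output m n a b orc ?p). packing_ok m n a b (ind_vec Y)"
    using ok_alg_output by blast
qed

end
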